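(* For every $u_0\in L^2(X,\nu)$ there is $u_\infty\in\{u\in L^2(X,\nu): 0\in\Delta_1^m(u)\}$ such that $$\lim_{t\to\infty}e^{t\Delta_1^m}u_0=u_\infty\quad\text{in } L^2(X,\nu).$$ Moreover, if $\nu(X)<\infty$, then $$u_\infty=\frac1{\nu(X)}\int_X u_0(x)\,d\nu(x).$$
   Context: Metric random walk space: $(X,d)$ is a Polish metric space with its Borel $\sigma$-algebra and $m=(m_x)_{x\in X}$ is a family of Borel probability measures on $X$ such that $x\mapsto m_x(A)$ is Borel for every Borel set $A$, and each $m_x$ has finite first moment ($\int_X d(z,y)\,dm_x(y)<\infty$ for some, hence every, $z\in X$). $\nu$ is a $\sigma$-finite Radon measure on $X$ that is invariant, $\nu(A)=\int_X m_x(A)\,d\nu(x)$, and reversible for $m$: for every Borel $C\subset X\times X$, $\int_X\int_X\chi_C(x,y)\,dm_x(y)d\nu(x)=\int_X\int_X\chi_C(x,y)\,dm_y(x)d\nu(y)$. Put $L_m(A,B)=\int_A\int_B dm_x(y)d\nu(x)$; the space is assumed $m$-connected: $L_m(A,B)>0$ for any $\nu$-measurable sets $A,B$ of positive $\nu$-measure with $A\cup B=X$. For $\nu$-measurable $u:X\to\mathbb R$, $TV_m(u)=\frac12\int_X\int_X|u(y)-u(x)|\,dm_x(y)d\nu(x)\in[0,\infty]$. Define $\mathcal F_m:L^2(X,\nu)\to[0,+\infty]$ by $\mathcal F_m(u)=TV_m(u)$ (value $+\infty$ if this integral is infinite). $w\in\partial\mathcal F_m(u)$ iff $\mathcal F_m(u)<\infty$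 and $\mathcal F_m(z)\ge\mathcal F_m(u)+\int_X w(z-u)\,d\nu$ for all $z\in L^2(X,\nu)$. The multivalued operator $\Delta_1^m$ in $L^2(X,\nu)$: $v\in\Delta_1^m u$ iff $-v\in\partial\mathcal F_m(u)$. For $u_0\in L^2(X,\nu)$, $t\mapsto e^{t\Delta_1^m}u_0$ (the Total Variation Flow) denotes the unique solution $u$ of $u_t\in\Delta_1^m u$, $u(0)=u_0$, in the sense that for every $T>0$: $u\in W^{1,1}(0,T;L^2(X,\nu))$, $u(0)=u_0$, and $u_t(t)\in\Delta_1^m u(t)$ for almost all $t\in(0,T)$. *)

theory Defs
  imports "HOL-Probability.Probability"
begin

definition radon_measure :: "'a::metric_space measure \<Rightarrow> bool" where
  "radon_measure \<nu> \<longleftrightarrow>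
     sets \<nu> = sets borel \<and>
     (\<forall>x. \<exists>U. open U \<and> x \<in> U \<and> emeasure \<nu> U < \<infinity>) \<and>
     (\<forall>A\<in>sets borel. emeasure \<nu> A = (SUP K\<in>{K. compact K \<and> K \<subseteq> A}. emeasure \<nu> K))"

locale metric_random_walk =
  fixes m :: "'a::polish_space \<Rightarrow> 'a measure"
  assumes prob_space_m: "prob_space (m x)"
    and sets_m: "sets (m x) = sets borel"
    and measurable_m: "A \<in> sets borel \<Longrightarrow> (\<lambda>x. emeasure (m x) A) \<in> borel_measurable borel"
    and first_moment: "\<exists>z. (\<integral>\<^sup>+y. ennreal (dist z y) \<partial>m x) < \<infinity>"

locale reversible_random_walk_space = metric_random_walk m
  for m :: "'a::polish_space \<Rightarrow> 'a measure" +
  fixes \<nu> :: "'a measure"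
  assumes sigma_finite: "sigma_finite_measure \<nu>"
    and radon: "radon_measure \<nu>"
    and invariant: "A \<in> sets borel \<Longrightarrow> emeasure \<nu> A = (\<integral>\<^sup>+x. emeasure (m x) A \<partial>\<nu>)"
    and reversible: "C \<in> sets (borel :: ('a \<times> 'a) measure) \<Longrightarrow>
      (\<integral>\<^sup>+x. (\<integral>\<^sup>+y. indicator C (x, y) \<partial>m x) \<partial>\<nu>) = (\<integral>\<^sup>+y. (\<integral>\<^sup>+x. indicator C (x, y) \<partial>m y) \<partial>\<nu>)"

definition L_m :: "('a \<Rightarrow> 'a measure) \<Rightarrow> 'a measure \<Rightarrow> 'a set \<Rightarrow> 'a set \<Rightarrow> ennreal" where
  "L_m m \<nu> A B = (\<integral>\<^sup>+x\<in>A. (\<integral>\<^sup>+y\<in>B. 1 \<partial>m x) \<partial>\<nu>)"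

text \<open>Here and below, Borel sets and functions stand for $\nu$-measurable ones: they agree up to
  $\nu$-null sets, which by invariance are $m_x$-null for $\nu$-almost every $x$.\<close>

definition m_connected :: "('a \<Rightarrow> 'a measure) \<Rightarrow> 'a measure \<Rightarrow> bool" where
  "m_connected m \<nu> \<longleftrightarrow>
     (\<forall>A\<in>sets \<nu>. \<forall>B\<in>sets \<nu>.
        emeasure \<nu> A > 0 \<longrightarrow> emeasure \<nu> B > 0 \<longrightarrow> A \<union> B = space \<nu> \<longrightarrow> L_m m \<nu> A B > 0)"

text \<open>Elements of $L^2(M)$ are represented by measurable functions; two representatives of the same
  class agree almost everywhere, i.e. have L2-distance zero. L2-norm is only meaningful on
  L2-space (the Bochner integral is zero for non-integrable integrands).\<close>

definition L2_space :: "'a measure \<Rightarrow> ('a \<Rightarrow> real) set" where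
  "L2_space M = {f \<in> borel_measurable M. integrable M (\<lambda>x. (f x)\<^sup>2)}"

definition L2_norm :: "'a measure \<Rightarrow> ('a \<Rightarrow> real) \<Rightarrow> real" where
  "L2_norm M f = sqrt (\<integral>x. (f x)\<^sup>2 \<partial>M)"

definition TV_m :: "('a \<Rightarrow> 'a measure) \<Rightarrow> 'a measure \<Rightarrow> ('a \<Rightarrow> real) \<Rightarrow> ennreal" where
  "TV_m m \<nu> u = 1/2 * (\<integral>\<^sup>+x. (\<integral>\<^sup>+y. ennreal \<bar>u y - u x\<bar> \<partial>m x) \<partial>\<nu>)"

definition L2_subdifferential ::
  "'a measure \<Rightarrow> (('a \<Rightarrow> real) \<Rightarrow> ennreal) \<Rightarrow> ('a \<Rightarrow> real) \<Rightarrow> ('a \<Rightarrow> real) set" where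
  "L2_subdifferential M F u =
     {w \<in> L2_space M. u \<in> L2_space M \<and> F u < \<infinity> \<and>
        (\<forall>z\<in>L2_space M.
           enn2ereal (F z) \<ge> enn2ereal (F u) + ereal (\<integral>x. w x * (z x - u x) \<partial>M))}"

definition Delta_1 :: "('a \<Rightarrow> 'a measure) \<Rightarrow> 'a measure \<Rightarrow> ('a \<Rightarrow> real) \<Rightarrow> ('a \<Rightarrow> real) set" where
  "Delta_1 m \<nu> u = {v. (\<lambda>x. - v x) \<in> L2_subdifferential \<nu> (TV_m m \<nu>) u}"

text \<open>The space $L^2(M)$ depends on the measure $M$ and hence is not a type, so the Bochner integral
  of an $L^2(M)$-valued function on a finite measure space $N$ is defined here, following
  the definition of the library's has-bochner-integral: $L^1$-approximation by simple functions.
  The almost everywhere convergence is strong measurability of $v$.\<close>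

definition L2_simple :: "'a measure \<Rightarrow> 'b measure \<Rightarrow> ('b \<Rightarrow> 'a \<Rightarrow> real) \<Rightarrow> bool" where
  "L2_simple M N s \<longleftrightarrow> simple_function N s \<and> s ` space N \<subseteq> L2_space M"

definition L2_simple_integral :: "'b measure \<Rightarrow> ('b \<Rightarrow> 'a \<Rightarrow> real) \<Rightarrow> 'a \<Rightarrow> real" where
  "L2_simple_integral N s = (\<lambda>x. \<Sum>f\<in>s ` space N. measure N {t \<in> space N. s t = f} * f x)"

definition has_L2_integral ::
  "'a measure \<Rightarrow> 'b measure \<Rightarrow> ('b \<Rightarrow> 'a \<Rightarrow> real) \<Rightarrow> ('a \<Rightarrow> real) \<Rightarrow> bool" where
  "has_L2_integral M N v y \<longleftrightarrow>
     y \<in> L2_space M \<and> (AE t in N. v t \<in> L2_space M) \<and>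
     (\<exists>s. (\<forall>n. L2_simple M N (s n)) \<and>
        (AE t in N. (\<lambda>n. L2_norm M (\<lambda>x. v t x - s n t x)) \<longlonglongrightarrow> 0) \<and>
        (\<lambda>n. \<integral>\<^sup>+t. ennreal (L2_norm M (\<lambda>x. v t x - s n t x)) \<partial>N) \<longlonglongrightarrow> 0 \<and>
        (\<lambda>n. L2_norm M (\<lambda>x. y x - L2_simple_integral N (s n) x)) \<longlonglongrightarrow> 0)"

text \<open>$u \in W^{1,1}(0,T;L^2(M))$ with derivative $u_t = v \in L^1(0,T;L^2(M))$, that is,
  $u(t) = u(0) + \int_0^t v(s)\,ds$. This makes $u$ the continuous representative of its class,
  which gives $u(0)$ and the behaviour of $u(t)$ as $t \to \infty$ their meaning.\<close>

definition W11_with_derivative ::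
  "'a measure \<Rightarrow> real \<Rightarrow> (real \<Rightarrow> 'a \<Rightarrow> real) \<Rightarrow> (real \<Rightarrow> 'a \<Rightarrow> real) \<Rightarrow> bool" where
  "W11_with_derivative M T u v \<longleftrightarrow>
     (\<forall>t\<in>{0..T}. u t \<in> L2_space M \<and>
        has_L2_integral M (lebesgue_on {0..t}) v (\<lambda>x. u t x - u 0 x))"

text \<open>The relation "$u$ is the solution $t \mapsto e^{t\Delta_1^m} u_0$"; well-posedness of the Cauchy
  problem is not built in.\<close>

definition total_variation_flow ::
  "('a \<Rightarrow> 'a measure) \<Rightarrow> 'a measure \<Rightarrow> ('a \<Rightarrow> real) \<Rightarrow> (real \<Rightarrow> 'a \<Rightarrow> real) \<Rightarrow> bool" where
  "total_variation_flow m \<nu> u0 u \<longleftrightarrow>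
     (AE x in \<nu>. u 0 x = u0 x) \<and>
     (\<forall>T>0. \<exists>v. W11_with_derivative \<nu> T u v \<and>
        (AE t in lebesgue_on {0..T}. v t \<in> Delta_1 m \<nu> (u t)))"

end

theory Submission
  imports Defs
begin

text \<open>
  The limit is forced to be a constant: \<open>0 \<in> \<Delta>\<^sub>1 u\<close> means that $u$ has zero
  total variation, and connectedness makes such a function constant.  In $L^2$ a constant is zero
  when $\nu(X)=\infty$; when $\nu(X)<\infty$ the flow preserves the mean.  So there is a single
  constant $c$, depending on $u_0$ only, such that $u_0-c$ is orthogonal to every constant function
  in $L^2$, and the task is to show $\|u(t)-c\|\to 0$ for every solution $u$.

  Put $F=TV_m$.  Since $F$ is even and positively homogeneous, $v\in\Delta_1^m u$ says that
  $\langle v,u\rangle=-F(u)$ and $|\langle v,z\rangle|\le F(z)$ for all $z$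
  (\<open>Delta_1_D\<close>).  Two estimates follow.  First, $\|u(t)-c\|^2$ decreases at rate $2F(u(t))$
  (\<open>total_variation_flow_dissipation\<close>).  Secondly,
  $\langle u(t)-u_0,z\rangle\le t\,F(z)$ (\<open>total_variation_flow_increment\<close>), that is,
  in the norm dual to $F$ the flow has moved at most a distance $t$ from $u_0$.
  If moreover $u_0-c$ had a finite dual norm $K$, that is $|\langle u_0-c,z\rangle|\le K\,F(z)$,
  then $z=u(t)-c$ would give $\|u(t)-c\|^2\le (t+K)F(u(t))$: as long as $\|u(t)-c\|\ge\eta$,
  the dissipation is at least of order $\eta^2/t$, which is not integrable, and this contradicts
  the boundedness of $\|u(t)-c\|^2$.  A small $L^2$-error in $u_0-c$ costs only a small multiple of
  $\|u(0)-c\|$, so it suffices that the functions of finite dual norm are dense in the orthogonal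
  complement of the constants (\<open>TV_dual_approximation\<close>).

  For the density, let $m$ act by averaging, $Ph(x)=\int h\,dm_x$.  Reversibility gives the
  discrete Green formula
  $\langle h-Ph,z\rangle=\frac12\int\int(h(y)-h(x))(z(y)-z(x))\,dm_x(y)\,d\nu(x)$
  (\<open>green_formula\<close>), so $h-Ph$ has finite dual norm when $h$ is bounded.  A function $r$ that
  is orthogonal to all of these is in particular orthogonal to $h-Ph$ for $h=\arctan r$; the
  integrand is then nonnegative and vanishes only where $r(x)=r(y)$, so $r$ is invariant under the
  walk and hence constant.  Orthogonal projection, which rests on the completeness of $L^2$, turns
  this into density.
\<close>

section \<open>The geometry of $L^2$\<close>

definition L2_inner :: "'a measure \<Rightarrow> ('a \<Rightarrow> real) \<Rightarrow> ('a \<Rightarrow> real) \<Rightarrow> real" where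
  "L2_inner M f g = (\<integral>x. f x * g x \<partial>M)"

lemma L2_spaceD:
  assumes "f \<in> L2_space M"
  shows "f \<in> borel_measurable M" "integrable M (\<lambda>x. (f x)\<^sup>2)"
  using assms by (auto simp: L2_space_def)

lemma L2_integrable_mult:
  assumes "f \<in> L2_space M" "g \<in> L2_space M"
  shows "integrable M (\<lambda>x. f x * g x)"
proof (rule Bochner_Integration.integrable_bound)
  show "integrable M (\<lambda>x. (f x)\<^sup>2 + (g x)\<^sup>2)"
    using assms by (simp add: L2_space_def)
  show "(\<lambda>x. f x * g x) \<in> borel_measurable M"
    using assms by (intro borel_measurable_times L2_spaceD)
  have "\<bar>a * b\<bar> \<le> a\<^sup>2 + b\<^sup>2" for a b :: real
    using sum_squares_bound[of "\<bar>a\<bar>" "\<bar>b\<bar>"] abs_ge_zero[of "a * b"]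
    unfolding abs_mult power2_abs by linarith
  then show "AE x in M. norm (f x * g x) \<le> norm ((f x)\<^sup>2 + (g x)\<^sup>2)"
    by (auto simp del: power2_eq_square)
qed

lemma L2_space_add:
  assumes "f \<in> L2_space M" "g \<in> L2_space M"
  shows "(\<lambda>x. f x + g x) \<in> L2_space M"
proof -
  have "integrable M (\<lambda>x. (f x)\<^sup>2 + (g x)\<^sup>2 + 2 * (f x * g x))"
    using assms L2_integrable_mult[OF assms] by (simp add: L2_space_def)
  then show ?thesis
    using assms by (auto simp: L2_space_def power2_sum algebra_simps)
qed

lemma L2_space_scale: "f \<in> L2_space M \<Longrightarrow> (\<lambda>x. c * f x) \<in> L2_space M"
  by (auto simp: L2_space_def power_mult_distrib)

lemma L2_space_diff:
  assumes "f \<in> L2_space M" "g \<in> L2_space M"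
  shows "(\<lambda>x. f x - g x) \<in> L2_space M"
  using L2_space_add[OF assms(1) L2_space_scale[OF assms(2), of "-1"]] by simp

lemma L2_space_zero: "(\<lambda>_. 0) \<in> L2_space M"
  by (simp add: L2_space_def)

lemma L2_space_sum:
  "(\<And>i. i \<in> I \<Longrightarrow> f i \<in> L2_space M) \<Longrightarrow> (\<lambda>x. \<Sum>i\<in>I. f i x) \<in> L2_space M"
  by (induction I rule: infinite_finite_induct) (auto simp: L2_space_zero intro: L2_space_add)

lemma L2_inner_commute: "L2_inner M f g = L2_inner M g f"
  by (simp add: L2_inner_def mult.commute)

lemma L2_inner_diff_left:
  assumes "f \<in> L2_space M" "g \<in> L2_space M" "h \<in> L2_space M"
  shows "L2_inner M (\<lambda>x. f x - g x) h = L2_inner M f h - L2_inner M g h"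
  using L2_integrable_mult[OF assms(1,3)] L2_integrable_mult[OF assms(2,3)]
  by (simp add: L2_inner_def left_diff_distrib)

lemma L2_inner_diff_right:
  assumes "f \<in> L2_space M" "g \<in> L2_space M" "h \<in> L2_space M"
  shows "L2_inner M h (\<lambda>x. f x - g x) = L2_inner M h f - L2_inner M h g"
  using L2_inner_diff_left[OF assms] by (simp add: L2_inner_commute)

lemma L2_inner_scale_left: "L2_inner M (\<lambda>x. c * f x) h = c * L2_inner M f h"
  by (simp add: L2_inner_def mult.assoc)

lemma L2_inner_scale_right: "L2_inner M h (\<lambda>x. c * f x) = c * L2_inner M h f"
  by (simp add: L2_inner_def mult.left_commute)

lemma L2_inner_sum_left:
  assumes "\<And>i. i \<in> I \<Longrightarrow> f i \<in> L2_space M" "h \<in> L2_space M"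
  shows "L2_inner M (\<lambda>x. \<Sum>i\<in>I. f i x) h = (\<Sum>i\<in>I. L2_inner M (f i) h)"
  using assms by (simp add: L2_inner_def sum_distrib_right L2_integrable_mult)

lemma L2_norm_nonneg [simp]: "0 \<le> L2_norm M f"
  by (simp add: L2_norm_def)

lemma L2_norm_square: "(L2_norm M f)\<^sup>2 = L2_inner M f f"
  by (simp add: L2_norm_def L2_inner_def power2_eq_square)

lemma L2_norm_square_diff:
  assumes "f \<in> L2_space M" "g \<in> L2_space M"
  shows "(L2_norm M (\<lambda>x. f x - g x))\<^sup>2 = (L2_norm M f)\<^sup>2 - 2 * L2_inner M f g + (L2_norm M g)\<^sup>2"
  unfolding L2_norm_square using assms L2_space_diff[OF assms]
  by (simp add: L2_inner_diff_left L2_inner_diff_right L2_inner_commute)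

lemma L2_norm_minus_commute: "L2_norm M (\<lambda>x. f x - g x) = L2_norm M (\<lambda>x. g x - f x)"
  by (simp add: L2_norm_def power2_commute)

lemma L2_Cauchy_Schwarz:
  assumes f: "f \<in> L2_space M" and g: "g \<in> L2_space M"
  shows "\<bar>L2_inner M f g\<bar> \<le> L2_norm M f * L2_norm M g"
proof -
  let ?a = "(L2_norm M f)\<^sup>2" and ?b = "L2_inner M f g" and ?c = "(L2_norm M g)\<^sup>2"
  have quad: "0 \<le> ?a - 2 * s * ?b + s\<^sup>2 * ?c" for s
  proof -
    have "0 \<le> (L2_norm M (\<lambda>x. f x - s * g x))\<^sup>2" by simp
    also have "\<dots> = ?a - 2 * (s * ?b) + s\<^sup>2 * ?c"
      unfolding L2_norm_square_diff[OF f L2_space_scale[OF g]]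
      by (simp add: L2_norm_square L2_inner_scale_left L2_inner_scale_right)
        (simp add: power2_eq_square)
    finally show ?thesis by simp
  qed
  have "?b\<^sup>2 \<le> ?a * ?c"
  proof (cases "?c = 0")
    case True
    have "?b = 0"
    proof (rule ccontr)
      assume "?b \<noteq> 0"
      (* With c = 0 the quadratic is affine in s, and this s makes it equal to -1. *)
      then show False
        using quad[of "(?a + 1) / (2 * ?b)"] True by (simp add: field_simps)
    qed
    then show ?thesis by simp
  next
    case False
    then have c: "?c > 0" by (simp add: less_le)
    have "?c * (?a - 2 * (?b / ?c) * ?b + (?b / ?c)\<^sup>2 * ?c) \<ge> 0"
      using quad[of "?b / ?c"] c by (intro mult_nonneg_nonneg) auto
    also have "?c * (?a - 2 * (?b / ?c) * ?b + (?b / ?c)\<^sup>2 * ?c) = ?a * ?c - ?b\<^sup>2"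
      using False by (simp add: field_simps power2_eq_square)
    finally show ?thesis by simp
  qed
  then have "\<bar>?b\<bar>\<^sup>2 \<le> (L2_norm M f * L2_norm M g)\<^sup>2"
    by (simp add: power_mult_distrib)
  then show ?thesis
    by (rule power2_le_imp_le) simp
qed

lemma L2_norm_triangle:
  assumes f: "f \<in> L2_space M" and g: "g \<in> L2_space M"
  shows "L2_norm M f \<le> L2_norm M (\<lambda>x. f x - g x) + L2_norm M g"
proof (rule power2_le_imp_le)
  let ?d = "\<lambda>x. f x - g x"
  have d: "?d \<in> L2_space M" by (rule L2_space_diff[OF f g])
  have "(L2_norm M f)\<^sup>2 = (L2_norm M ?d)\<^sup>2 + 2 * L2_inner M ?d g + (L2_norm M g)\<^sup>2"
    using L2_norm_square_diff[OF f g] L2_inner_diff_left[OF f g g] by (simp add: L2_norm_square)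
  also have "\<dots> \<le> (L2_norm M ?d + L2_norm M g)\<^sup>2"
    using L2_Cauchy_Schwarz[OF d g] by (simp add: power2_sum)
  finally show "(L2_norm M f)\<^sup>2 \<le> (L2_norm M ?d + L2_norm M g)\<^sup>2" .
qed simp

lemma L2_norm_triangle_abs:
  assumes f: "f \<in> L2_space M" and g: "g \<in> L2_space M"
  shows "\<bar>L2_norm M f - L2_norm M g\<bar> \<le> L2_norm M (\<lambda>x. f x - g x)"
  using L2_norm_triangle[OF f g] L2_norm_triangle[OF g f] L2_norm_minus_commute[of M f g] by auto

text \<open>Completeness of $L^2$, in the quantitative form for sequences that converge geometrically.
  Weighting the squared increments by $2^n$ keeps their integrals summable, so almost everywhere the
  increments themselves are $O(2^{-n/2})$ and the sequence converges pointwise; Fatou's lemma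
  bounds the distance to the limit.\<close>

lemma L2_complete_geometric:
  fixes f :: "nat \<Rightarrow> 'a \<Rightarrow> real"
  assumes f: "\<And>n. f n \<in> L2_space M"
    and fast: "\<And>n k. n \<le> k \<Longrightarrow> (L2_norm M (\<lambda>x. f n x - f k x))\<^sup>2 \<le> C * (1/4) ^ n"
  shows "\<exists>g\<in>L2_space M. \<forall>n. (L2_norm M (\<lambda>x. f n x - g x))\<^sup>2 \<le> C * (1/4) ^ n"
proof -
  have [measurable]: "f n \<in> borel_measurable M" for n
    using f by (auto dest: L2_spaceD)
  have sq: "(\<integral>\<^sup>+x. ennreal ((f n x - f k x)\<^sup>2) \<partial>M) = ennreal ((L2_norm M (\<lambda>x. f n x - f k x))\<^sup>2)" for n k
    using L2_space_diff[OF f f, of n k]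
    by (subst nn_integral_eq_integral) (auto dest: L2_spaceD simp: L2_norm_def)
  have C: "0 \<le> C"
    using fast[of 0 0] by (simp add: L2_norm_def)
  have "(\<integral>\<^sup>+x. (\<Sum>n. ennreal (2 ^ n * (f n x - f (Suc n) x)\<^sup>2)) \<partial>M)
      = (\<Sum>n. \<integral>\<^sup>+x. ennreal (2 ^ n * (f n x - f (Suc n) x)\<^sup>2) \<partial>M)"
    by (rule nn_integral_suminf) measurable
  also have "\<dots> \<le> (\<Sum>n. ennreal (C * (1/2) ^ n))"
  proof (intro suminf_le)
    fix n
    have "(\<integral>\<^sup>+x. ennreal (2 ^ n * (f n x - f (Suc n) x)\<^sup>2) \<partial>M)
        = ennreal (2 ^ n) * ennreal ((L2_norm M (\<lambda>x. f n x - f (Suc n) x))\<^sup>2)"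
      by (subst sq[symmetric], subst nn_integral_cmult[symmetric]) (auto simp: ennreal_mult)
    also have "\<dots> \<le> ennreal (2 ^ n) * ennreal (C * (1/4) ^ n)"
      by (intro mult_left_mono ennreal_leI fast) auto
    also have "\<dots> = ennreal (C * (2 ^ n * (1/4) ^ n))"
      using C by (subst ennreal_mult[symmetric]) (auto simp: mult_ac)
    also have "\<dots> = ennreal (C * (1/2) ^ n)"
      by (simp only: power_mult_distrib[symmetric]) simp
    finally show "(\<integral>\<^sup>+x. ennreal (2 ^ n * (f n x - f (Suc n) x)\<^sup>2) \<partial>M) \<le> ennreal (C * (1/2) ^ n)" .
  qed auto
  also have "\<dots> = ennreal (\<Sum>n. C * (1/2) ^ n)"
    using C by (intro suminf_ennreal2) (auto intro!: summable_mult summable_geometric)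
  also have "\<dots> < \<infinity>" by simp
  finally have "AE x in M. (\<Sum>n. ennreal (2 ^ n * (f n x - f (Suc n) x)\<^sup>2)) \<noteq> \<infinity>"
    by (intro nn_integral_noteq_infinite) auto
  then have conv: "AE x in M. convergent (\<lambda>n. f n x)"
  proof eventually_elim
    case (elim x)
    have "summable (\<lambda>n. 2 ^ n * (f n x - f (Suc n) x)\<^sup>2)"
      using elim by (intro summable_suminf_not_top) auto
    then have "Bseq (\<lambda>n. 2 ^ n * (f n x - f (Suc n) x)\<^sup>2)"
      using summable_LIMSEQ_zero convergentI convergent_imp_Bseq by blast
    then obtain B where B: "\<And>n. 2 ^ n * (f n x - f (Suc n) x)\<^sup>2 \<le> B"
      by (auto simp: Bseq_def abs_mult)
    have step: "norm (f (Suc n) x - f n x) \<le> sqrt B * sqrt (1/2) ^ n" for n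
    proof -
      have "(f n x - f (Suc n) x)\<^sup>2 \<le> B * (1/2) ^ n"
        using B[of n] by (simp add: field_simps)
      then have "\<bar>f n x - f (Suc n) x\<bar> \<le> sqrt (B * (1/2) ^ n)"
        by (intro real_le_rsqrt) simp
      then show ?thesis
        by (simp add: real_sqrt_mult real_sqrt_power abs_minus_commute)
    qed
    have "summable (\<lambda>n. sqrt B * sqrt (1/2) ^ n)"
      by (intro summable_mult summable_geometric) (simp add: real_sqrt_divide)
    then have "summable (\<lambda>n. f (Suc n) x - f n x)"
      by (rule summable_comparison_test') (use step in auto)
    then have "convergent (\<lambda>n. \<Sum>i<n. f (Suc i) x - f i x)"
      by (rule summable_iff_convergent[THEN iffD1])
    then have "convergent (\<lambda>n. f n x - f 0 x + f 0 x)"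
      unfolding sum_lessThan_telescope[of "\<lambda>i. f i x"] by (rule convergent_add) (rule convergent_const)
    then show ?case by simp
  qed
  define g where "g x = lim (\<lambda>n. f n x)" for x
  have [measurable]: "g \<in> borel_measurable M"
    unfolding g_def by measurable
  have lim: "AE x in M. (\<lambda>n. f n x) \<longlonglongrightarrow> g x"
    using conv by eventually_elim (simp add: g_def convergent_LIMSEQ_iff)
  have bound: "(\<integral>\<^sup>+x. ennreal ((f n x - g x)\<^sup>2) \<partial>M) \<le> ennreal (C * (1/4) ^ n)" for n
  proof -
    have "(\<integral>\<^sup>+x. ennreal ((f n x - g x)\<^sup>2) \<partial>M)
        = (\<integral>\<^sup>+x. liminf (\<lambda>k. ennreal ((f n x - f k x)\<^sup>2)) \<partial>M)"
    proof (intro nn_integral_cong_AE, use lim in eventually_elim)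
      case (elim x)
      have "(\<lambda>k. ennreal ((f n x - f k x)\<^sup>2)) \<longlonglongrightarrow> ennreal ((f n x - g x)\<^sup>2)"
        by (intro tendsto_intros elim)
      then show ?case
        using lim_imp_Liminf[OF sequentially_bot] by metis
    qed
    also have "\<dots> \<le> liminf (\<lambda>k. \<integral>\<^sup>+x. ennreal ((f n x - f k x)\<^sup>2) \<partial>M)"
      by (rule nn_integral_liminf) measurable
    also have "\<dots> \<le> liminf (\<lambda>k. ennreal (C * (1/4) ^ n))"
      by (intro Liminf_mono eventually_sequentiallyI[of n])
         (auto simp: sq intro!: ennreal_leI fast)
    also have "\<dots> = ennreal (C * (1/4) ^ n)"
      by (simp add: Liminf_const)
    finally show ?thesis .
  qed
  have diff: "(\<lambda>x. f n x - g x) \<in> L2_space M" for n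
    using bound[of n] by (auto simp: L2_space_def integrable_iff_bounded intro: le_less_trans)
  have "g \<in> L2_space M"
    using L2_space_diff[OF f diff, of 0 0] by simp
  moreover have "(L2_norm M (\<lambda>x. f n x - g x))\<^sup>2 \<le> C * (1/4) ^ n" for n
  proof -
    have "ennreal ((L2_norm M (\<lambda>x. f n x - g x))\<^sup>2) \<le> ennreal (C * (1/4) ^ n)"
      using bound[of n] diff[of n]
      by (subst (asm) nn_integral_eq_integral) (auto dest: L2_spaceD simp: L2_norm_def)
    then show ?thesis
      using C by (simp add: ennreal_le_iff)
  qed
  ultimately show ?thesis by blast
qed

text \<open>Projection onto the closure of a subspace: a minimising sequence for the distance from $f$
  has a limiting residual $r$, and minimality makes $r$ orthogonal to the subspace.  By hypothesis
  $f$ is then orthogonal to $r$ as well, so $\|r\|^2=\langle f,r\rangle=0$ and the distance is zero.\<close>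

lemma L2_approximation_by_subspace:
  assumes D: "D \<subseteq> L2_space M" and zero: "(\<lambda>_. 0) \<in> D"
    and add: "\<And>g h. g \<in> D \<Longrightarrow> h \<in> D \<Longrightarrow> (\<lambda>x. g x + h x) \<in> D"
    and scale: "\<And>c g. g \<in> D \<Longrightarrow> (\<lambda>x. c * g x) \<in> D"
    and f: "f \<in> L2_space M"
    and perp: "\<And>r. r \<in> L2_space M \<Longrightarrow> (\<And>g. g \<in> D \<Longrightarrow> L2_inner M r g = 0) \<Longrightarrow> L2_inner M f r = 0"
    and e: "e > 0"
  shows "\<exists>g\<in>D. L2_norm M (\<lambda>x. f x - g x) < e"
proof -
  define N where "N g = (L2_norm M (\<lambda>x. f x - g x))\<^sup>2" for g
  define \<delta> where "\<delta> = (INF g\<in>D. N g)"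
  have bdd: "bdd_below (N ` D)"
    by (rule bdd_belowI[of _ 0]) (auto simp: N_def)
  have \<delta>_le: "\<delta> \<le> N g" if "g \<in> D" for g
    unfolding \<delta>_def using bdd that by (rule cINF_lower)
  have "\<exists>g\<in>D. N g < \<delta> + (1/4) ^ n" for n
    using zero unfolding \<delta>_def by (subst cINF_less_iff[OF _ bdd, symmetric]) auto
  then obtain d where dD: "\<And>n. d n \<in> D" and dN: "\<And>n. N (d n) < \<delta> + (1/4) ^ n"
    by metis
  have d: "d n \<in> L2_space M" for n
    using dD D by auto
  define q where "q n x = f x - d n x" for n x
  have q: "q n \<in> L2_space M" for n
    unfolding q_def[abs_def] using f d by (rule L2_space_diff)
  have qN: "(L2_norm M (q n))\<^sup>2 = N (d n)" for n
    by (simp add: N_def q_def[abs_def])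
  have sub: "(\<lambda>x. g x - c * h x) \<in> D" if "g \<in> D" "h \<in> D" for g h c
    using add[OF that(1) scale[OF that(2), of "- c"]] by simp
  \<comment> \<open>The midpoint of two almost minimisers lies in the subspace, so by the parallelogram identity
    they are close to each other.\<close>
  have "(L2_norm M (\<lambda>x. q n x - q k x))\<^sup>2 \<le> 4 * (1/4) ^ n" if "n \<le> k" for n k
  proof -
    have "(\<lambda>x. (1/2) * (d n x + d k x)) \<in> D"
      by (intro scale add dD)
    then have "\<delta> \<le> N (\<lambda>x. (1/2) * (d n x + d k x))"
      by (rule \<delta>_le)
    also have "\<dots> = (L2_norm M (\<lambda>x. (1/2) * (q n x + q k x)))\<^sup>2"
      by (simp add: N_def q_def algebra_simps)
    also have "\<dots> = (1/4) * (L2_norm M (\<lambda>x. q n x - (-1) * q k x))\<^sup>2"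
      unfolding L2_norm_square L2_inner_scale_left L2_inner_scale_right by simp
    also have "(L2_norm M (\<lambda>x. q n x - (-1) * q k x))\<^sup>2
        = (L2_norm M (q n))\<^sup>2 + 2 * L2_inner M (q n) (q k) + (L2_norm M (q k))\<^sup>2"
    proof -
      have "L2_norm M (\<lambda>x. - 1 * q k x) = L2_norm M (q k)"
        by (simp add: L2_norm_def)
      then show ?thesis
        using L2_norm_square_diff[OF q L2_space_scale[OF q], of n "-1" k]
        unfolding L2_inner_scale_right by simp
    qed
    finally have "4 * \<delta> \<le> (L2_norm M (q n))\<^sup>2 + 2 * L2_inner M (q n) (q k) + (L2_norm M (q k))\<^sup>2"
      by simp
    moreover have "(1/4::real) ^ k \<le> (1/4) ^ n"
      using that by (intro power_decreasing) auto
    ultimately show ?thesis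
      using dN[of n] dN[of k] L2_norm_square_diff[OF q q, of n k] unfolding qN by linarith
  qed
  then obtain r where r: "r \<in> L2_space M"
    and qr: "\<And>n. (L2_norm M (\<lambda>x. q n x - r x))\<^sup>2 \<le> 4 * (1/4) ^ n"
    using L2_complete_geometric[of q M 4] q by blast
  have "(\<lambda>n. 4 * (1/4::real) ^ n) \<longlonglongrightarrow> 0"
    by (intro tendsto_mult_right_zero LIMSEQ_realpow_zero) auto
  then have "(\<lambda>n. (L2_norm M (\<lambda>x. q n x - r x))\<^sup>2) \<longlonglongrightarrow> 0"
    by (rule real_tendsto_sandwich[rotated 2, OF tendsto_const]) (use qr in auto)
  then have "(\<lambda>n. sqrt ((L2_norm M (\<lambda>x. q n x - r x))\<^sup>2)) \<longlonglongrightarrow> sqrt 0"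
    by (rule tendsto_real_sqrt)
  then have lim: "(\<lambda>n. L2_norm M (\<lambda>x. q n x - r x)) \<longlonglongrightarrow> 0"
    by simp
  have inner_lim: "(\<lambda>n. L2_inner M (q n) h) \<longlonglongrightarrow> L2_inner M r h" if h: "h \<in> L2_space M" for h
  proof (rule LIM_zero_cancel, rule tendsto_rabs_zero_cancel,
      rule real_tendsto_sandwich[OF _ _ tendsto_const])
    show "\<forall>\<^sub>F n in sequentially. \<bar>L2_inner M (q n) h - L2_inner M r h\<bar>
        \<le> L2_norm M (\<lambda>x. q n x - r x) * L2_norm M h"
      using L2_Cauchy_Schwarz[OF L2_space_diff[OF q r] h] L2_inner_diff_left[OF q r h] by auto
    show "(\<lambda>n. L2_norm M (\<lambda>x. q n x - r x) * L2_norm M h) \<longlonglongrightarrow> 0"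
      by (rule tendsto_mult_left_zero[OF lim])
  qed auto
  have norm_lim: "(\<lambda>n. (L2_norm M (q n))\<^sup>2) \<longlonglongrightarrow> (L2_norm M r)\<^sup>2"
  proof (intro tendsto_power, rule LIM_zero_cancel, rule tendsto_rabs_zero_cancel,
      rule real_tendsto_sandwich[OF _ _ tendsto_const lim])
    show "\<forall>\<^sub>F n in sequentially. \<bar>L2_norm M (q n) - L2_norm M r\<bar> \<le> L2_norm M (\<lambda>x. q n x - r x)"
      using L2_norm_triangle_abs[OF q r] by auto
  qed auto
  have "(\<lambda>n. \<delta> + (1/4) ^ n) \<longlonglongrightarrow> \<delta> + 0"
    by (intro tendsto_add tendsto_const LIMSEQ_realpow_zero) auto
  then have geo: "(\<lambda>n. \<delta> + (1/4) ^ n) \<longlonglongrightarrow> \<delta>" by simp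
  have "(\<lambda>n. (L2_norm M (q n))\<^sup>2) \<longlonglongrightarrow> \<delta>"
  proof (rule real_tendsto_sandwich[OF always_eventually always_eventually tendsto_const geo])
    show "\<forall>n. \<delta> \<le> (L2_norm M (q n))\<^sup>2"
      using \<delta>_le[OF dD] by (simp only: qN) blast
    show "\<forall>n. (L2_norm M (q n))\<^sup>2 \<le> \<delta> + (1/4) ^ n"
      using less_imp_le[OF dN] by (simp only: qN) blast
  qed
  then have r_norm: "(L2_norm M r)\<^sup>2 = \<delta>"
    using norm_lim LIMSEQ_unique by blast
  have r_perp: "L2_inner M r g = 0" if g: "g \<in> D" for g
  proof (rule ccontr)
    assume ne: "L2_inner M r g \<noteq> 0"
    have gL: "g \<in> L2_space M" using g D by auto
    let ?b = "L2_inner M r g" and ?c = "(L2_norm M g)\<^sup>2"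
    have ge: "\<delta> \<le> \<delta> - 2 * s * ?b + s\<^sup>2 * ?c" for s
    proof (rule LIMSEQ_le_const)
      show "(\<lambda>n. (L2_norm M (q n))\<^sup>2 - 2 * s * L2_inner M (q n) g + s\<^sup>2 * ?c) \<longlonglongrightarrow>
          \<delta> - 2 * s * ?b + s\<^sup>2 * ?c"
        unfolding r_norm[symmetric] by (intro tendsto_intros norm_lim inner_lim gL)
      have "\<delta> \<le> (L2_norm M (q n))\<^sup>2 - 2 * s * L2_inner M (q n) g + s\<^sup>2 * ?c" for n
      proof -
        have "\<delta> \<le> N (\<lambda>x. d n x - (- s) * g x)"
          by (intro \<delta>_le sub dD g)
        also have "\<dots> = (L2_norm M (\<lambda>x. q n x - s * g x))\<^sup>2"
          by (simp add: N_def q_def algebra_simps)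
        also have "\<dots> = (L2_norm M (q n))\<^sup>2 - 2 * s * L2_inner M (q n) g + s\<^sup>2 * ?c"
          unfolding L2_norm_square_diff[OF q L2_space_scale[OF gL]]
          unfolding L2_norm_square L2_inner_scale_left L2_inner_scale_right
          by (simp add: power2_eq_square)
        finally show ?thesis .
      qed
      then show "\<exists>n0. \<forall>n\<ge>n0. \<delta> \<le> (L2_norm M (q n))\<^sup>2 - 2 * s * L2_inner M (q n) g + s\<^sup>2 * ?c"
        by blast
    qed
    (* The optimal s would be b / c; adding 1 avoids dividing by zero when g has norm zero. *)
    define s where "s = ?b / (?c + 1)"
    have c1: "?c + 1 > 0" by (intro add_nonneg_pos) auto
    then have b: "?b = s * (?c + 1)" by (simp add: s_def)
    have "s\<^sup>2 * (?c + 2) = 2 * s * ?b - s\<^sup>2 * ?c"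
      unfolding b by (simp add: algebra_simps power2_eq_square)
    also have "\<dots> \<le> 0" using ge[of s] by simp
    finally have "s\<^sup>2 * (?c + 2) \<le> 0" .
    moreover have "s\<^sup>2 * (?c + 2) > 0"
      using ne c1 by (intro mult_pos_pos) (auto simp: s_def)
    ultimately show False by simp
  qed
  have "L2_inner M f r = 0"
    using perp[OF r] r_perp by blast
  then have "L2_inner M (q n) r = 0" for n
    using L2_inner_diff_left[OF f d r, of n] r_perp[OF dD] by (simp add: q_def[abs_def] L2_inner_commute)
  then have "L2_inner M r r = 0"
    using inner_lim[OF r] LIMSEQ_unique[OF tendsto_const, of 0 "L2_inner M r r"] by simp
  then have "\<delta> < e\<^sup>2"
    using r_norm e by (simp add: L2_norm_square)
  then obtain g where "g \<in> D" "N g < e\<^sup>2"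
    using zero cINF_less_iff[OF _ bdd, of "e\<^sup>2"] unfolding \<delta>_def by auto
  then show ?thesis
    using e power2_less_imp_less[of _ e] unfolding N_def by (intro bexI[of _ g]) auto
qed

section \<open>Jumps of the walk, averages and the Green formula\<close>

text \<open>Fubini's theorem for a measure composed with a kernel, for signed integrands.  The nonnegative
  case is the corresponding fact for nonnegative integrals; the positive and the negative part are
  then subtracted, which is legitimate because almost every inner integral is finite.\<close>

lemma integral_bind_kernel:
  fixes g :: "'b \<Rightarrow> real"
  assumes K: "K \<in> M \<rightarrow>\<^sub>M subprob_algebra B" and ne: "space M \<noteq> {}"
    and g: "integrable (M \<bind> K) g"
  shows "(\<integral>p. g p \<partial>(M \<bind> K)) = (\<integral>x. (\<integral>p. g p \<partial>K x) \<partial>M)"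
    and "integrable M (\<lambda>x. \<integral>p. g p \<partial>K x)"
proof -
  have sets_bind: "sets (M \<bind> K) = sets B"
    by (rule sets_bind_measurable[OF K ne])
  have sets_K: "sets (K x) = sets B" if "x \<in> space M" for x
    by (rule sets_kernel[OF K that])
  have nonneg: "(\<integral>p. f p \<partial>(M \<bind> K)) = (\<integral>x. (\<integral>p. f p \<partial>K x) \<partial>M) \<and>
      integrable M (\<lambda>x. \<integral>p. f p \<partial>K x) \<and> (AE x in M. integrable (K x) f)"
    if f: "integrable (M \<bind> K) f" and pos: "\<And>p. 0 \<le> f p" for f :: "'b \<Rightarrow> real"
  proof -
    have meas[measurable]: "f \<in> borel_measurable B"
      using borel_measurable_integrable[OF f] by (simp add: measurable_cong_sets[OF sets_bind refl])
    have Kf: "f \<in> borel_measurable (K x)" if "x \<in> space M" for x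
      using meas by (simp add: measurable_cong_sets[OF sets_K[OF that] refl])
    have outer: "(\<lambda>x. \<integral>\<^sup>+p. ennreal (f p) \<partial>K x) \<in> borel_measurable M"
      by (rule measurable_compose[OF K nn_integral_measurable_subprob_algebra]) measurable
    have eq: "(\<integral>\<^sup>+x. (\<integral>\<^sup>+p. ennreal (f p) \<partial>K x) \<partial>M) = ennreal (\<integral>p. f p \<partial>(M \<bind> K))"
      using nn_integral_bind[OF _ K, of "\<lambda>p. ennreal (f p)"] nn_integral_eq_integral[OF f] pos by simp
    then have "AE x in M. (\<integral>\<^sup>+p. ennreal (f p) \<partial>K x) \<noteq> \<infinity>"
      by (intro nn_integral_noteq_infinite outer) simp
    then have int: "AE x in M. integrable (K x) f"
      using AE_space by eventually_elim (use pos Kf in \<open>auto simp: integrable_iff_bounded top.not_eq_extremum\<close>)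
    have "(\<integral>\<^sup>+x. ennreal (\<integral>p. f p \<partial>K x) \<partial>M) = ennreal (\<integral>p. f p \<partial>(M \<bind> K))"
      unfolding eq[symmetric]
      by (intro nn_integral_cong_AE, use int in eventually_elim) (simp add: nn_integral_eq_integral pos)
    moreover have "(\<lambda>x. \<integral>p. f p \<partial>K x) \<in> borel_measurable M"
      by (rule measurable_compose[OF K integral_measurable_subprob_algebra]) measurable
    ultimately show ?thesis
      using int pos
      by (auto simp: integrable_iff_bounded integral_eq_nn_integral intro!: integral_nonneg_AE)
  qed
  let ?p = "\<lambda>p. max 0 (g p)" and ?n = "\<lambda>p. max 0 (- g p)"
  have int: "integrable (M \<bind> K) ?p" "integrable (M \<bind> K) ?n"
    using g by auto
  note P = nonneg[OF int(1) max.cobounded1] and N = nonneg[OF int(2) max.cobounded1]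
  have meas_g: "g \<in> borel_measurable B"
    using borel_measurable_integrable[OF g] by (simp add: measurable_cong_sets[OF sets_bind refl])
  have split: "g p = ?p p - ?n p" for p by auto
  have AE: "AE x in M. (\<integral>p. g p \<partial>K x) = (\<integral>p. ?p p \<partial>K x) - (\<integral>p. ?n p \<partial>K x)"
    using P[THEN conjunct2, THEN conjunct2] N[THEN conjunct2, THEN conjunct2]
  proof eventually_elim
    case (elim x)
    have "(\<integral>p. g p \<partial>K x) = (\<integral>p. ?p p - ?n p \<partial>K x)"
      by (rule Bochner_Integration.integral_cong[OF refl split])
    then show ?case
      by (simp only: Bochner_Integration.integral_diff[OF elim])
  qed
  have meas: "(\<lambda>x. \<integral>p. g p \<partial>K x) \<in> borel_measurable M"
    by (rule measurable_compose[OF K integral_measurable_subprob_algebra[OF meas_g]])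
  have "(\<integral>p. g p \<partial>(M \<bind> K)) = (\<integral>p. ?p p \<partial>(M \<bind> K)) - (\<integral>p. ?n p \<partial>(M \<bind> K))"
    by (subst Bochner_Integration.integral_diff[symmetric, OF int]) (auto intro!: Bochner_Integration.integral_cong)
  also have "\<dots> = (\<integral>x. (\<integral>p. ?p p \<partial>K x) - (\<integral>p. ?n p \<partial>K x) \<partial>M)"
    using P N by simp
  also have "\<dots> = (\<integral>x. (\<integral>p. g p \<partial>K x) \<partial>M)"
    using AE P N meas by (intro integral_cong_AE) (auto dest: borel_measurable_integrable)
  finally show "(\<integral>p. g p \<partial>(M \<bind> K)) = (\<integral>x. (\<integral>p. g p \<partial>K x) \<partial>M)" .
  have "integrable M (\<lambda>x. (\<integral>p. ?p p \<partial>K x) - (\<integral>p. ?n p \<partial>K x))"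
    using P N by simp
  then show "integrable M (\<lambda>x. \<integral>p. g p \<partial>K x)"
    by (rule integrable_cong_AE_imp[OF _ meas]) (use AE in eventually_elim, simp)
qed

context reversible_random_walk_space
begin

lemma sets_nu [measurable_cong]: "sets \<nu> = sets borel"
  using radon by (simp add: radon_measure_def)

lemma space_nu [simp]: "space \<nu> = UNIV"
  using sets_eq_imp_space_eq[OF sets_nu] by simp

declare sets_m [measurable_cong]

lemma space_m [simp]: "space (m x) = UNIV"
  using sets_eq_imp_space_eq[OF sets_m, of x] by simp

lemma L2_space_borel: "u \<in> L2_space \<nu> \<Longrightarrow> u \<in> borel_measurable borel"
  by (auto simp: L2_space_def measurable_cong_sets[OF sets_nu refl])

lemma kernel [measurable]: "m \<in> borel \<rightarrow>\<^sub>M subprob_algebra borel"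
  by (rule measurable_subprob_algebra)
    (auto simp: prob_space_m prob_space_imp_subprob_space sets_m measurable_m)

text \<open>The law of one step $(x,y)$ of the walk started from $\nu$, that is $d\nu(x)\,dm_x(y)$.
  Both marginals are $\nu$ (by the normalisation of $m_x$ and by invariance) and reversibility is
  invariance under the swap, so every computation with $TV_m$ and with averages becomes one
  with $L^2$-functions on a single measure space.\<close>

definition jump :: "('a \<times> 'a) measure" where
  "jump = \<nu> \<bind> (\<lambda>x. distr (m x) borel (Pair x))"

lemma jump_kernel: "(\<lambda>x. distr (m x) borel (Pair x)) \<in> \<nu> \<rightarrow>\<^sub>M subprob_algebra borel"
proof (rule measurable_distr2[where M = borel])
  show "case_prod Pair \<in> \<nu> \<Otimes>\<^sub>M borel \<rightarrow>\<^sub>M (borel :: ('a \<times> 'a) measure)"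
    unfolding borel_prod[symmetric] by measurable
  show "m \<in> \<nu> \<rightarrow>\<^sub>M subprob_algebra borel"
    by measurable
qed

lemma sets_jump [measurable_cong]: "sets jump = sets borel"
  unfolding jump_def by (rule sets_bind_measurable[OF jump_kernel]) simp

lemma space_jump [simp]: "space jump = UNIV"
  using sets_eq_imp_space_eq[OF sets_jump] by simp

lemma Pair_borel [measurable]: "Pair x \<in> (borel :: 'a measure) \<rightarrow>\<^sub>M (borel :: ('a \<times> 'a) measure)"
  unfolding borel_prod[symmetric] by measurable

lemma nn_integral_jump:
  assumes [measurable]: "g \<in> borel_measurable borel"
  shows "(\<integral>\<^sup>+p. g p \<partial>jump) = (\<integral>\<^sup>+x. (\<integral>\<^sup>+y. g (x, y) \<partial>m x) \<partial>\<nu>)"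
  unfolding jump_def
  by (subst nn_integral_bind[OF _ jump_kernel]) (auto simp: nn_integral_distr)

lemma emeasure_jump:
  assumes "C \<in> sets borel"
  shows "emeasure jump C = (\<integral>\<^sup>+x. (\<integral>\<^sup>+y. indicator C (x, y) \<partial>m x) \<partial>\<nu>)"
proof -
  have "emeasure jump C = (\<integral>\<^sup>+p. indicator C p \<partial>jump)"
    using assms by (subst nn_integral_indicator) (simp_all add: sets_jump)
  then show ?thesis
    by (simp only: nn_integral_jump[OF borel_measurable_indicator[OF assms]])
qed

lemma swap_borel [measurable]: "(prod.swap :: 'a \<times> 'a \<Rightarrow> _) \<in> borel \<rightarrow>\<^sub>M borel"
  unfolding borel_prod[symmetric] prod.swap_def by measurable

lemma fst_borel [measurable]: "(fst :: 'a \<times> 'a \<Rightarrow> _) \<in> borel \<rightarrow>\<^sub>M borel"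
  and snd_borel [measurable]: "(snd :: 'a \<times> 'a \<Rightarrow> _) \<in> borel \<rightarrow>\<^sub>M borel"
  unfolding borel_prod[symmetric] by measurable

lemma distr_jump_swap: "distr jump borel prod.swap = jump"
proof (rule measure_eqI)
  fix C assume "C \<in> sets (distr jump borel prod.swap)"
  then have C: "C \<in> sets borel" by simp
  then have C': "prod.swap -` C \<in> sets borel"
    using measurable_sets[OF swap_borel C] by simp
  have "emeasure (distr jump borel prod.swap) C = emeasure jump (prod.swap -` C)"
    using C by (subst emeasure_distr) (auto simp: measurable_cong_sets[OF sets_jump refl])
  also have "\<dots> = (\<integral>\<^sup>+x. (\<integral>\<^sup>+y. indicator C (y, x) \<partial>m x) \<partial>\<nu>)"
    unfolding emeasure_jump[OF C'] by (simp add: indicator_def)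
  also have "\<dots> = emeasure jump C"
    unfolding emeasure_jump[OF C] by (rule reversible[OF C, symmetric])
  finally show "emeasure (distr jump borel prod.swap) C = emeasure jump C" .
qed (simp add: sets_jump)

lemma distr_jump_fst: "distr jump borel fst = \<nu>"
proof (rule measure_eqI)
  fix A assume "A \<in> sets (distr jump borel fst)"
  then have A[measurable]: "A \<in> sets borel" by simp
  have A': "fst -` A \<in> sets (borel :: ('a \<times> 'a) measure)"
    using measurable_sets[OF fst_borel A] by simp
  have "emeasure (distr jump borel fst) A = emeasure jump (fst -` A)"
    using A by (subst emeasure_distr) (auto simp: measurable_cong_sets[OF sets_jump refl])
  also have "\<dots> = (\<integral>\<^sup>+x. (\<integral>\<^sup>+y. indicator A x \<partial>m x) \<partial>\<nu>)"
    unfolding emeasure_jump[OF A'] by (simp add: indicator_def)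
  also have "\<dots> = (\<integral>\<^sup>+x. indicator A x \<partial>\<nu>)"
    using prob_space.emeasure_space_1[OF prob_space_m] by simp
  finally show "emeasure (distr jump borel fst) A = emeasure \<nu> A" by (simp add: sets_nu)
qed (simp add: sets_nu)

lemma distr_jump_snd: "distr jump borel snd = \<nu>"
proof -
  have "distr jump borel fst = distr (distr jump borel prod.swap) borel fst"
    by (simp add: distr_jump_swap)
  also have "\<dots> = distr jump borel (fst \<circ> prod.swap)"
    by (rule distr_distr) (auto simp: measurable_cong_sets[OF sets_jump refl])
  also have "fst \<circ> prod.swap = (snd :: 'a \<times> 'a \<Rightarrow> 'a)" by auto
  finally show ?thesis by (simp add: distr_jump_fst)
qed

lemma integral_jump_fst:
  fixes f :: "'a \<Rightarrow> real"
  assumes "f \<in> borel_measurable borel"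
  shows "(\<integral>p. f (fst p) \<partial>jump) = (\<integral>x. f x \<partial>\<nu>)"
    and "integrable jump (\<lambda>p. f (fst p)) \<longleftrightarrow> integrable \<nu> f"
  using integral_distr[of fst jump borel f] integrable_distr_eq[of fst jump borel f] assms
  by (auto simp: distr_jump_fst measurable_cong_sets[OF sets_jump refl])

lemma integral_jump_snd:
  fixes f :: "'a \<Rightarrow> real"
  assumes "f \<in> borel_measurable borel"
  shows "(\<integral>p. f (snd p) \<partial>jump) = (\<integral>x. f x \<partial>\<nu>)"
    and "integrable jump (\<lambda>p. f (snd p)) \<longleftrightarrow> integrable \<nu> f"
  using integral_distr[of snd jump borel f] integrable_distr_eq[of snd jump borel f] assms
  by (auto simp: distr_jump_snd measurable_cong_sets[OF sets_jump refl])

lemma integral_jump_swap: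
  fixes g :: "'a \<times> 'a \<Rightarrow> real"
  assumes "g \<in> borel_measurable borel"
  shows "(\<integral>p. g (snd p, fst p) \<partial>jump) = (\<integral>p. g p \<partial>jump)"
  using integral_distr[of prod.swap jump borel g] assms
  by (auto simp: distr_jump_swap measurable_cong_sets[OF sets_jump refl] prod.swap_def)

lemma L2_space_jump:
  assumes u: "u \<in> L2_space \<nu>"
  shows "(\<lambda>p. u (fst p)) \<in> L2_space jump" "(\<lambda>p. u (snd p)) \<in> L2_space jump"
proof -
  have [measurable]: "u \<in> borel_measurable borel" by (rule L2_space_borel[OF u])
  show "(\<lambda>p. u (fst p)) \<in> L2_space jump" "(\<lambda>p. u (snd p)) \<in> L2_space jump"
    using u integral_jump_fst(2)[of "\<lambda>x. (u x)\<^sup>2"] integral_jump_snd(2)[of "\<lambda>x. (u x)\<^sup>2"]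
    by (auto simp: L2_space_def)
qed

lemma TV_m_eq_jump:
  assumes [measurable]: "u \<in> borel_measurable borel"
  shows "TV_m m \<nu> u = 1/2 * (\<integral>\<^sup>+p. ennreal \<bar>u (snd p) - u (fst p)\<bar> \<partial>jump)"
  unfolding TV_m_def by (subst nn_integral_jump) auto

lemma TV_m_finite:
  assumes [measurable]: "u \<in> borel_measurable borel" and fin: "TV_m m \<nu> u < \<infinity>"
  shows "integrable jump (\<lambda>p. \<bar>u (snd p) - u (fst p)\<bar>)"
    and "TV_m m \<nu> u = ennreal (1/2 * (\<integral>p. \<bar>u (snd p) - u (fst p)\<bar> \<partial>jump))"
proof -
  have "(\<integral>\<^sup>+p. ennreal \<bar>u (snd p) - u (fst p)\<bar> \<partial>jump) < \<infinity>"
    using fin unfolding TV_m_eq_jump[OF assms(1)] by (auto simp: ennreal_mult_less_top top.not_eq_extremum)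
  then show int: "integrable jump (\<lambda>p. \<bar>u (snd p) - u (fst p)\<bar>)"
    by (auto simp: integrable_iff_bounded)
  have half: "1/2 = ennreal (1/2)"
    using divide_ennreal[of 1 2] by simp
  show "TV_m m \<nu> u = ennreal (1/2 * (\<integral>p. \<bar>u (snd p) - u (fst p)\<bar> \<partial>jump))"
    unfolding TV_m_eq_jump[OF assms(1)] half nn_integral_eq_integral[OF int AE_I2[OF abs_ge_zero]]
    by (rule ennreal_mult'[symmetric]) simp
qed

definition average :: "('a \<Rightarrow> real) \<Rightarrow> 'a \<Rightarrow> real" where
  "average h x = (\<integral>y. h y \<partial>m x)"

text \<open>Averaging is an $L^2$-contraction: Jensen's inequality for each $m_x$, then invariance of
  $\nu$.  Boundedness of $h$ ensures that it is integrable against every single $m_x$.\<close>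

lemma average_L2:
  assumes h: "h \<in> L2_space \<nu>" and bdd: "\<And>x. \<bar>h x\<bar> \<le> C"
  shows "average h \<in> L2_space \<nu>"
proof -
  have [measurable]: "h \<in> borel_measurable borel" by (rule L2_space_borel[OF h])
  have meas[measurable]: "average h \<in> borel_measurable borel"
    unfolding average_def[abs_def]
    by (rule measurable_compose[OF kernel integral_measurable_subprob_algebra]) measurable
  have sq: "(average h x)\<^sup>2 \<le> (\<integral>y. (h y)\<^sup>2 \<partial>m x)" for x
  proof -
    interpret prob_space "m x" by (rule prob_space_m)
    have "integrable (m x) h"
      by (rule integrable_const_bound[of _ C]) (use bdd in auto)
    moreover have "integrable (m x) (\<lambda>y. (h y)\<^sup>2)"
      by (rule integrable_const_bound[of _ "C\<^sup>2"])
        (use bdd in \<open>auto intro!: AE_I2 simp: abs_le_square_iff[symmetric] order_trans[OF _ abs_ge_self]\<close>)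
    ultimately have "variance h = expectation (\<lambda>y. (h y)\<^sup>2) - (expectation h)\<^sup>2"
      by (rule variance_eq)
    then show ?thesis
      using variance_positive[of h] by (simp add: average_def)
  qed
  have int: "integrable jump (\<lambda>p. (h (snd p))\<^sup>2)"
    using integral_jump_snd(2)[of "\<lambda>x. (h x)\<^sup>2"] h by (simp add: L2_space_def)
  have "integrable \<nu> (\<lambda>x. \<integral>p. (h (snd p))\<^sup>2 \<partial>distr (m x) borel (Pair x))"
    by (rule integral_bind_kernel(2)[OF jump_kernel]) (use int in \<open>auto simp: jump_def\<close>)
  then have "integrable \<nu> (\<lambda>x. \<integral>y. (h y)\<^sup>2 \<partial>m x)"
    by (simp add: integral_distr)
  then have "integrable \<nu> (\<lambda>x. (average h x)\<^sup>2)"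
    by (rule Bochner_Integration.integrable_bound) (use sq in \<open>auto intro!: AE_I2 intro: order_trans\<close>)
  then show ?thesis
    by (simp add: L2_space_def)
qed

lemma inner_average:
  assumes h: "h \<in> L2_space \<nu>" and z: "z \<in> L2_space \<nu>"
  shows "L2_inner \<nu> (average h) z = (\<integral>p. h (snd p) * z (fst p) \<partial>jump)"
proof -
  have [measurable]: "h \<in> borel_measurable borel" "z \<in> borel_measurable borel"
    using h z by (auto intro: L2_space_borel)
  have "integrable jump (\<lambda>p. h (snd p) * z (fst p))"
    by (intro L2_integrable_mult L2_space_jump h z)
  then have "(\<integral>p. h (snd p) * z (fst p) \<partial>jump)
      = (\<integral>x. (\<integral>p. h (snd p) * z (fst p) \<partial>distr (m x) borel (Pair x)) \<partial>\<nu>)"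
    unfolding jump_def by (intro integral_bind_kernel(1)[OF jump_kernel]) auto
  also have "\<dots> = (\<integral>x. (\<integral>y. h y * z x \<partial>m x) \<partial>\<nu>)"
    by (simp add: integral_distr)
  finally show ?thesis
    by (simp add: L2_inner_def average_def)
qed

text \<open>Integration by parts: the swap invariance of the one-step law symmetrises
  $\int\int (h(x)-h(y))\,z(x)$ in $x$ and $y$.\<close>

lemma green_formula:
  assumes h: "h \<in> L2_space \<nu>" and bdd: "\<And>x. \<bar>h x\<bar> \<le> C" and z: "z \<in> L2_space \<nu>"
  shows "L2_inner \<nu> (\<lambda>x. h x - average h x) z
    = 1/2 * (\<integral>p. (h (snd p) - h (fst p)) * (z (snd p) - z (fst p)) \<partial>jump)"
proof -
  have meas[measurable]: "h \<in> borel_measurable borel" "z \<in> borel_measurable borel"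
    using h z by (auto intro: L2_space_borel)
  note int = L2_integrable_mult[OF L2_space_jump(1)[OF h] L2_space_jump(1)[OF z]]
    L2_integrable_mult[OF L2_space_jump(1)[OF h] L2_space_jump(2)[OF z]]
    L2_integrable_mult[OF L2_space_jump(2)[OF h] L2_space_jump(1)[OF z]]
    L2_integrable_mult[OF L2_space_jump(2)[OF h] L2_space_jump(2)[OF z]]
  have "(\<integral>p. (h (snd p) - h (fst p)) * (z (snd p) - z (fst p)) \<partial>jump)
      = (\<integral>p. h (snd p) * z (snd p) - h (snd p) * z (fst p)
            - (h (fst p) * z (snd p) - h (fst p) * z (fst p)) \<partial>jump)"
    by (intro Bochner_Integration.integral_cong) (auto simp: algebra_simps)
  also have "\<dots> = (\<integral>p. h (snd p) * z (snd p) \<partial>jump) - (\<integral>p. h (snd p) * z (fst p) \<partial>jump)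
      - ((\<integral>p. h (fst p) * z (snd p) \<partial>jump) - (\<integral>p. h (fst p) * z (fst p) \<partial>jump))"
    using int by simp
  also have "(\<integral>p. h (snd p) * z (snd p) \<partial>jump) = L2_inner \<nu> h z"
    unfolding L2_inner_def by (rule integral_jump_snd) measurable
  also have "(\<integral>p. h (fst p) * z (fst p) \<partial>jump) = L2_inner \<nu> h z"
    unfolding L2_inner_def by (rule integral_jump_fst) measurable
  also have "(\<integral>p. h (fst p) * z (snd p) \<partial>jump) = (\<integral>p. h (snd p) * z (fst p) \<partial>jump)"
    using integral_jump_swap[of "\<lambda>p. h (snd p) * z (fst p)"] by simp
  also have "(\<integral>p. h (snd p) * z (fst p) \<partial>jump) = L2_inner \<nu> (average h) z"
    by (rule inner_average[OF h z, symmetric])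
  finally show ?thesis
    using L2_inner_diff_left[OF h average_L2[OF h bdd] z] by simp
qed

text \<open>The functions that are finite in the norm dual to $TV_m$: they pair with every function of
  finite total variation as if they were divergences of bounded vector fields.\<close>

definition TV_dual :: "('a \<Rightarrow> real) set" where
  "TV_dual = {f \<in> L2_space \<nu>. \<exists>K\<ge>0. \<forall>z\<in>L2_space \<nu>. TV_m m \<nu> z < \<infinity> \<longrightarrow>
     \<bar>L2_inner \<nu> f z\<bar> \<le> K * enn2real (TV_m m \<nu> z)}"

text \<open>In the Green formula the increments of $h$ are bounded by $2C$, and what remains is the
  total variation of $z$.\<close>

lemma diff_average_in_TV_dual:
  assumes h: "h \<in> L2_space \<nu>" and bdd: "\<And>x. \<bar>h x\<bar> \<le> C"
  shows "(\<lambda>x. h x - average h x) \<in> TV_dual"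
proof -
  have C: "0 \<le> C" using bdd[of undefined] by linarith
  have "\<bar>L2_inner \<nu> (\<lambda>x. h x - average h x) z\<bar> \<le> 2 * C * enn2real (TV_m m \<nu> z)"
    if z: "z \<in> L2_space \<nu>" and fin: "TV_m m \<nu> z < \<infinity>" for z
  proof -
    note TV = TV_m_finite[OF L2_space_borel[OF z] fin]
    have "\<bar>\<integral>p. (h (snd p) - h (fst p)) * (z (snd p) - z (fst p)) \<partial>jump\<bar>
        \<le> (\<integral>p. 2 * C * \<bar>z (snd p) - z (fst p)\<bar> \<partial>jump)"
    proof (rule order_trans[OF integral_abs_bound], rule integral_mono)
      show "integrable jump (\<lambda>p. \<bar>(h (snd p) - h (fst p)) * (z (snd p) - z (fst p))\<bar>)"
        by (intro integrable_abs L2_integrable_mult L2_space_diff L2_space_jump h z)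
      show "integrable jump (\<lambda>p. 2 * C * \<bar>z (snd p) - z (fst p)\<bar>)"
        using TV(1) by simp
      fix p
      have "\<bar>h (snd p) - h (fst p)\<bar> \<le> 2 * C"
        using bdd[of "snd p"] bdd[of "fst p"] by linarith
      then show "\<bar>(h (snd p) - h (fst p)) * (z (snd p) - z (fst p))\<bar> \<le> 2 * C * \<bar>z (snd p) - z (fst p)\<bar>"
        unfolding abs_mult by (rule mult_right_mono) simp
    qed
    then show ?thesis
      unfolding green_formula[OF h bdd z] TV(2) by (simp add: integral_nonneg_AE)
  qed
  then show ?thesis
    using L2_space_diff[OF h average_L2[OF h bdd]] C unfolding TV_dual_def
    by (intro CollectI conjI exI[of _ "2 * C"]) auto
qed

lemma TV_dual_add:
  assumes "f \<in> TV_dual" "g \<in> TV_dual"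
  shows "(\<lambda>x. f x + g x) \<in> TV_dual"
proof -
  obtain K L where fg: "f \<in> L2_space \<nu>" "g \<in> L2_space \<nu>" and K: "K \<ge> 0" "L \<ge> 0"
    and Kf: "\<And>z. z \<in> L2_space \<nu> \<Longrightarrow> TV_m m \<nu> z < \<infinity> \<Longrightarrow> \<bar>L2_inner \<nu> f z\<bar> \<le> K * enn2real (TV_m m \<nu> z)"
    and Lg: "\<And>z. z \<in> L2_space \<nu> \<Longrightarrow> TV_m m \<nu> z < \<infinity> \<Longrightarrow> \<bar>L2_inner \<nu> g z\<bar> \<le> L * enn2real (TV_m m \<nu> z)"
    using assms by (auto simp: TV_dual_def)
  have "\<bar>L2_inner \<nu> (\<lambda>x. f x + g x) z\<bar> \<le> (K + L) * enn2real (TV_m m \<nu> z)"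
    if z: "z \<in> L2_space \<nu>" "TV_m m \<nu> z < \<infinity>" for z
  proof -
    have "L2_inner \<nu> (\<lambda>x. f x + g x) z = L2_inner \<nu> f z + L2_inner \<nu> g z"
      using L2_integrable_mult[OF fg(1) z(1)] L2_integrable_mult[OF fg(2) z(1)]
      by (simp add: L2_inner_def distrib_right)
    then show ?thesis
      using Kf[OF z] Lg[OF z] by (simp add: distrib_right)
  qed
  then show ?thesis
    using K L2_space_add[OF fg] unfolding TV_dual_def
    by (intro CollectI conjI exI[of _ "K + L"]) auto
qed

lemma TV_dual_scale:
  assumes "f \<in> TV_dual"
  shows "(\<lambda>x. c * f x) \<in> TV_dual"
proof -
  obtain K where f: "f \<in> L2_space \<nu>" and K: "K \<ge> 0"
    and Kf: "\<And>z. z \<in> L2_space \<nu> \<Longrightarrow> TV_m m \<nu> z < \<infinity> \<Longrightarrow> \<bar>L2_inner \<nu> f z\<bar> \<le> K * enn2real (TV_m m \<nu> z)"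
    using assms by (auto simp: TV_dual_def)
  have "\<bar>L2_inner \<nu> (\<lambda>x. c * f x) z\<bar> \<le> \<bar>c\<bar> * K * enn2real (TV_m m \<nu> z)"
    if "z \<in> L2_space \<nu>" "TV_m m \<nu> z < \<infinity>" for z
    using Kf[OF that] by (simp add: L2_inner_scale_left abs_mult mult.assoc mult_left_mono)
  then show ?thesis
    using K L2_space_scale[OF f] unfolding TV_dual_def
    by (intro CollectI conjI exI[of _ "\<bar>c\<bar> * K"]) auto
qed

text \<open>Testing with $h-Ph$ for $h=\arctan r$ makes the integrand of the Green formula
  $(h(y)-h(x))(r(y)-r(x))$ nonnegative.  Any function that is bounded, strictly increasing and
  dominated in absolute value by the identity would serve in place of the arctangent.\<close>

lemma perp_TV_dual_imp_jump_invariant: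
  assumes r: "r \<in> L2_space \<nu>" and perp: "\<And>f. f \<in> TV_dual \<Longrightarrow> L2_inner \<nu> r f = 0"
  shows "AE p in jump. r (snd p) = r (fst p)"
proof -
  have [measurable]: "r \<in> borel_measurable borel" by (rule L2_space_borel[OF r])
  define h where "h x = arctan (r x)" for x
  have h_meas[measurable]: "h \<in> borel_measurable borel"
    unfolding h_def[abs_def] by measurable
  have "integrable \<nu> (\<lambda>x. (h x)\<^sup>2)"
  proof (rule Bochner_Integration.integrable_bound[OF L2_spaceD(2)[OF r]])
    show "AE x in \<nu>. norm ((h x)\<^sup>2) \<le> norm ((r x)\<^sup>2)"
      by (simp add: h_def abs_le_square_iff[symmetric] abs_arctan_le)
  qed measurable
  then have h: "h \<in> L2_space \<nu>"
    by (simp add: L2_space_def)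
  have bdd: "\<bar>h x\<bar> \<le> pi / 2" for x
    using arctan_ubound[of "r x"] arctan_lbound[of "r x"] by (simp add: h_def abs_le_iff)
  have "L2_inner \<nu> (\<lambda>x. h x - average h x) r = 0"
    using perp[OF diff_average_in_TV_dual[OF h bdd]] by (simp add: L2_inner_commute)
  then have zero: "(\<integral>p. (h (snd p) - h (fst p)) * (r (snd p) - r (fst p)) \<partial>jump) = 0"
    unfolding green_formula[OF h bdd r] by simp
  have mono: "0 \<le> (h (snd p) - h (fst p)) * (r (snd p) - r (fst p))" for p
    unfolding h_def by (cases "r (snd p) \<le> r (fst p)")
      (auto intro!: mult_nonneg_nonneg mult_nonpos_nonpos simp: arctan_le_iff)
  have "AE p in jump. (h (snd p) - h (fst p)) * (r (snd p) - r (fst p)) = 0"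
    using zero mono
    by (subst integral_nonneg_eq_0_iff_AE[symmetric])
      (auto intro!: L2_integrable_mult L2_space_diff L2_space_jump h r)
  then show ?thesis
    by eventually_elim (auto simp: h_def arctan_eq_iff)
qed

text \<open>For an invariant $r$ the walk never jumps from $\{r<q\}$ to $\{r\ge q\}$, so connectedness
  makes one of the two sets null for each level $q$; the constant is the supremum of the levels
  that $r$ almost everywhere attains or exceeds.\<close>

lemma jump_invariant_imp_AE_constant:
  assumes conn: "m_connected m \<nu>" and r[measurable]: "r \<in> borel_measurable borel"
    and inv: "AE p in jump. r (snd p) = r (fst p)"
  shows "\<exists>c. AE x in \<nu>. r x = (c::real)"
proof (cases "emeasure \<nu> UNIV = 0")
  case True
  then have "AE x in \<nu>. False"
    by (intro AE_I[of _ _ UNIV]) (auto simp: sets_nu)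
  then have "AE x in \<nu>. r x = 0" by eventually_elim simp
  then show ?thesis ..
next
  case False
  have nontrivial: "\<not> (AE x in \<nu>. False)"
    using False by (simp add: AE_iff_measurable[of UNIV] sets_nu)
  have dich: "(AE x in \<nu>. r x \<ge> q) \<or> (AE x in \<nu>. r x < q)" for q
  proof -
    let ?A = "{x. r x < q}" and ?B = "{x. q \<le> r x}"
    have A: "?A \<in> sets \<nu>" and B: "?B \<in> sets \<nu>"
      by (auto simp: sets_nu)
    have "L_m m \<nu> ?A ?B = (\<integral>\<^sup>+x. (\<integral>\<^sup>+y. indicator ?A x * indicator ?B y \<partial>m x) \<partial>\<nu>)"
      unfolding L_m_def by (intro nn_integral_cong) (simp add: indicator_def)
    also have "\<dots> = (\<integral>\<^sup>+p. indicator ?A (fst p) * indicator ?B (snd p) \<partial>jump)"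
      by (subst nn_integral_jump) auto
    also have "\<dots> = (\<integral>\<^sup>+p. 0 \<partial>jump)"
      by (intro nn_integral_cong_AE, use inv in eventually_elim) (auto simp: indicator_def)
    finally have "\<not> L_m m \<nu> ?A ?B > 0" by simp
    moreover have "?A \<union> ?B = space \<nu>" by auto
    ultimately have "emeasure \<nu> ?A = 0 \<or> emeasure \<nu> ?B = 0"
      using conn A B unfolding m_connected_def by (meson not_gr_zero)
    then show ?thesis
      using AE_iff_measurable[OF A, of "\<lambda>x. q \<le> r x"] AE_iff_measurable[OF B, of "\<lambda>x. r x < q"]
      by (auto simp: not_le not_less)
  qed
  define S where "S = {q. AE x in \<nu>. r x \<ge> q}"
  have "S \<noteq> {}"
  proof
    assume "S = {}"
    then have "AE x in \<nu>. \<forall>n. r x < - real n"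
      using dich by (auto simp: S_def AE_all_countable)
    then have "AE x in \<nu>. False"
    proof eventually_elim
      case (elim x)
      then show ?case
        using reals_Archimedean2[of "- r x"] by (metis less_asym minus_less_iff)
    qed
    then show False using nontrivial by blast
  qed
  have down: "q \<in> S" if "s \<in> S" "q \<le> s" for q s
    using that unfolding S_def by (auto elim!: eventually_mono)
  have "bdd_above S"
  proof (rule ccontr)
    assume unb: "\<not> bdd_above S"
    have "real n \<in> S" for n
      using unb down by (meson bdd_above.I linear)
    then have "AE x in \<nu>. \<forall>n. r x \<ge> real n"
      by (auto simp: S_def AE_all_countable)
    then have "AE x in \<nu>. False"
    proof eventually_elim
      case (elim x)
      then show ?case
        using reals_Archimedean2[of "r x"] by (metis not_less)
    qed
    then show False using nontrivial by blast
  qed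
  have "AE x in \<nu>. (q < Sup S \<longrightarrow> r x \<ge> q) \<and> (q > Sup S \<longrightarrow> r x < q)" for q
  proof (cases "q \<in> S")
    case True
    then have "q \<le> Sup S" using cSup_upper \<open>bdd_above S\<close> by blast
    then show ?thesis using True by (auto simp: S_def)
  next
    case False
    have "\<not> q < Sup S"
      using less_cSup_iff[OF \<open>S \<noteq> {}\<close> \<open>bdd_above S\<close>] down False by (meson less_imp_le)
    then show ?thesis using dich[of q] False by (auto simp: S_def)
  qed
  then have "AE x in \<nu>. \<forall>q::rat. (of_rat q < Sup S \<longrightarrow> r x \<ge> of_rat q) \<and> (of_rat q > Sup S \<longrightarrow> r x < of_rat q)"
    by (simp add: AE_all_countable)
  then have "AE x in \<nu>. r x = Sup S"
  proof eventually_elim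
    case (elim x)
    show ?case
    proof (rule ccontr)
      assume "r x \<noteq> Sup S"
      then consider "r x < Sup S" | "Sup S < r x" by linarith
      then show False
      proof cases
        case 1
        then obtain q :: rat where "r x < of_rat q" "of_rat q < Sup S"
          using of_rat_dense by blast
        then show False using elim by force
      next
        case 2
        then obtain q :: rat where "Sup S < of_rat q" "of_rat q < r x"
          using of_rat_dense by blast
        then show False using elim by force
      qed
    qed
  qed
  then show ?thesis ..
qed

end

section \<open>Curves in $L^2$ with an integrable derivative\<close>

text \<open>The Bochner integral of an $L^2$-valued function only provides simple functions that
  converge almost everywhere; since Lebesgue measure is complete, this still yields measurability
  of the norm and of all scalar products.\<close>

lemma measurable_AE_limit_lebesgue_on:
  fixes f :: "nat \<Rightarrow> 'b::euclidean_space \<Rightarrow> real"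
  assumes S: "S \<in> sets lebesgue" and f: "\<And>n. f n \<in> borel_measurable (lebesgue_on S)"
    and lim: "AE t in lebesgue_on S. (\<lambda>n. f n t) \<longlonglongrightarrow> g t"
  shows "g \<in> borel_measurable (lebesgue_on S)"
proof -
  define h where "h t = lim (\<lambda>n. f n t)" for t
  have h: "h \<in> borel_measurable (lebesgue_on S)"
    unfolding h_def[abs_def] using f by (rule borel_measurable_lim_metric)
  have "AE t in lebesgue_on S. h t = g t"
    using lim by eventually_elim (simp add: h_def limI)
  then have "AE t in lebesgue. (if t \<in> S then h t else 0) = (if t \<in> S then g t else 0)"
    using S by (subst (asm) AE_restrict_space_iff) (auto elim: eventually_mono)
  moreover have "(\<lambda>t. if t \<in> S then h t else 0) \<in> borel_measurable lebesgue"
    using h S by (simp add: borel_measurable_if)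
  ultimately have "(\<lambda>t. if t \<in> S then g t else 0) \<in> borel_measurable lebesgue"
    by (rule borel_measurable_AE[rotated])
  then show ?thesis
    using S by (simp add: borel_measurable_if)
qed

text \<open>The Bochner integral is used through its scalar products, for which it becomes an ordinary
  integral: the approximating simple functions of $v$ induce those of $\langle v,z\rangle$, with errors
  controlled by the Cauchy--Schwarz inequality.\<close>

lemma has_L2_integral_lebesgue_on:
  fixes v :: "real \<Rightarrow> 'a \<Rightarrow> real"
  assumes v: "has_L2_integral M (lebesgue_on {a..b}) v y"
  shows has_L2_integral_inner: "z \<in> L2_space M \<Longrightarrow>
      has_bochner_integral (lebesgue_on {a..b}) (\<lambda>t. L2_inner M (v t) z) (L2_inner M y z)"
    and has_L2_integral_norm: "integrable (lebesgue_on {a..b}) (\<lambda>t. L2_norm M (v t))"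
proof -
  let ?N = "lebesgue_on {a..b}"
  obtain s where y: "y \<in> L2_space M" and vL: "AE t in ?N. v t \<in> L2_space M"
    and s: "\<And>n. L2_simple M ?N (s n)"
    and conv: "AE t in ?N. (\<lambda>n. L2_norm M (\<lambda>x. v t x - s n t x)) \<longlonglongrightarrow> 0"
    and L1: "(\<lambda>n. \<integral>\<^sup>+t. ennreal (L2_norm M (\<lambda>x. v t x - s n t x)) \<partial>?N) \<longlonglongrightarrow> 0"
    and int: "(\<lambda>n. L2_norm M (\<lambda>x. y x - L2_simple_integral ?N (s n) x)) \<longlonglongrightarrow> 0"
    using v unfolding has_L2_integral_def by blast
  interpret N: finite_measure ?N
    by (rule finite_measure_lebesgue_on) simp
  have S: "{a..b} \<in> sets lebesgue" by simp
  have sL: "s n t \<in> L2_space M" if "t \<in> {a..b}" for n t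
    using s[of n] that by (auto simp: L2_simple_def)
  have sf: "simple_function ?N (s n)" for n
    using s[of n] by (simp add: L2_simple_def)
  have AE_mem: "AE t in ?N. t \<in> {a..b}"
    using AE_space[of ?N] by simp
  have norm_meas: "(\<lambda>t. L2_norm M (v t)) \<in> borel_measurable ?N"
  proof (rule measurable_AE_limit_lebesgue_on[OF S])
    show "(\<lambda>t. L2_norm M (s n t)) \<in> borel_measurable ?N" for n
      by (intro borel_measurable_simple_function simple_function_compose1[OF sf])
    show "AE t in ?N. (\<lambda>n. L2_norm M (s n t)) \<longlonglongrightarrow> L2_norm M (v t)"
      using conv vL AE_mem
    proof eventually_elim
      case (elim t)
      have "(\<lambda>n. L2_norm M (s n t) - L2_norm M (v t)) \<longlonglongrightarrow> 0"
        by (rule Lim_null_comparison[OF always_eventually elim(1)])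
          (use L2_norm_triangle_abs[OF elim(2) sL[OF elim(3)]] in \<open>simp add: abs_minus_commute\<close>)
      then show ?case by (rule LIM_zero_cancel)
    qed
  qed
  have diff_meas: "(\<lambda>t. L2_norm M (\<lambda>x. v t x - s n t x)) \<in> borel_measurable ?N" for n
  proof (rule measurable_AE_limit_lebesgue_on[OF S])
    show "(\<lambda>t. L2_norm M (\<lambda>x. s k t x - s n t x)) \<in> borel_measurable ?N" for k
      by (intro borel_measurable_simple_function simple_function_compose2[OF sf sf])
    show "AE t in ?N. (\<lambda>k. L2_norm M (\<lambda>x. s k t x - s n t x)) \<longlonglongrightarrow> L2_norm M (\<lambda>x. v t x - s n t x)"
      using conv vL AE_mem
    proof eventually_elim
      case (elim t)
      have "\<bar>L2_norm M (\<lambda>x. s k t x - s n t x) - L2_norm M (\<lambda>x. v t x - s n t x)\<bar>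
          \<le> L2_norm M (\<lambda>x. v t x - s k t x)" for k
        using L2_norm_triangle_abs[OF L2_space_diff[OF elim(2) sL[OF elim(3)]]
            L2_space_diff[OF sL[OF elim(3)] sL[OF elim(3)]], of n k n]
        by (simp add: abs_minus_commute)
      then have "(\<lambda>k. L2_norm M (\<lambda>x. s k t x - s n t x) - L2_norm M (\<lambda>x. v t x - s n t x)) \<longlonglongrightarrow> 0"
        by (intro Lim_null_comparison[OF always_eventually elim(1)]) simp
      then show ?case by (rule LIM_zero_cancel)
    qed
  qed
  show "integrable ?N (\<lambda>t. L2_norm M (v t))"
  proof -
    have "\<forall>\<^sub>F n in sequentially. (\<integral>\<^sup>+t. ennreal (L2_norm M (\<lambda>x. v t x - s n t x)) \<partial>?N) < 1"
      using order_tendstoD(2)[OF L1, of 1] by simp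
    then obtain n where n: "(\<integral>\<^sup>+t. ennreal (L2_norm M (\<lambda>x. v t x - s n t x)) \<partial>?N) < 1"
      by (auto simp: eventually_sequentially)
    have 1: "integrable ?N (\<lambda>t. L2_norm M (\<lambda>x. v t x - s n t x))"
      using n diff_meas by (auto simp: integrable_iff_bounded intro: less_trans)
    have 2: "integrable ?N (\<lambda>t. L2_norm M (s n t))"
      by (intro integrableI_simple_bochner_integrable simple_bochner_integrable.intros
          simple_function_compose1[OF sf]) (simp add: N.emeasure_finite)
    show ?thesis
    proof (rule Bochner_Integration.integrable_bound[OF Bochner_Integration.integrable_add[OF 1 2] norm_meas])
      show "AE t in ?N. norm (L2_norm M (v t)) \<le> norm (L2_norm M (\<lambda>x. v t x - s n t x) + L2_norm M (s n t))"
        using vL AE_mem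
      proof eventually_elim
        case (elim t)
        then show ?case
          using L2_norm_triangle[OF elim(1) sL[OF elim(2), of n]] by simp
      qed
    qed
  qed
  assume z: "z \<in> L2_space M"
  have diff_bound: "AE t in ?N. \<bar>L2_inner M (v t) z - L2_inner M (s n t) z\<bar>
      \<le> L2_norm M z * L2_norm M (\<lambda>x. v t x - s n t x)" for n
    using vL AE_mem
  proof eventually_elim
    case (elim t)
    note st = sL[OF elim(2), of n]
    show ?case
      using L2_Cauchy_Schwarz[OF L2_space_diff[OF elim(1) st] z]
      by (simp add: L2_inner_diff_left[OF elim(1) st z] mult.commute)
  qed
  have sf_inner: "simple_function ?N (\<lambda>t. L2_inner M (s n t) z)" for n
    by (rule simple_function_compose1[OF sf])
  have sbi: "Bochner_Integration.simple_bochner_integrable ?N (\<lambda>t. L2_inner M (s n t) z)" for n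
    by (rule simple_bochner_integrable.intros[OF sf_inner]) (simp add: N.emeasure_finite)
  show "has_bochner_integral ?N (\<lambda>t. L2_inner M (v t) z) (L2_inner M y z)"
  proof (rule has_bochner_integral.intros[OF _ sbi])
    show "(\<lambda>t. L2_inner M (v t) z) \<in> borel_measurable ?N"
    proof (rule measurable_AE_limit_lebesgue_on[OF S])
      show "(\<lambda>t. L2_inner M (s n t) z) \<in> borel_measurable ?N" for n
        by (intro borel_measurable_simple_function sf_inner)
      have "AE t in ?N. \<forall>n. \<bar>L2_inner M (v t) z - L2_inner M (s n t) z\<bar>
          \<le> L2_norm M z * L2_norm M (\<lambda>x. v t x - s n t x)"
        using diff_bound by (simp add: AE_all_countable)
      then show "AE t in ?N. (\<lambda>n. L2_inner M (s n t) z) \<longlonglongrightarrow> L2_inner M (v t) z"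
        using conv
      proof eventually_elim
        case (elim t)
        have "(\<lambda>n. L2_inner M (s n t) z - L2_inner M (v t) z) \<longlonglongrightarrow> 0"
          by (rule Lim_null_comparison[OF always_eventually tendsto_mult_right_zero[OF elim(2), of "L2_norm M z"]])
            (use elim(1) in \<open>simp add: abs_minus_commute\<close>)
        then show ?case by (rule LIM_zero_cancel)
      qed
    qed
    show "(\<lambda>n. \<integral>\<^sup>+t. ennreal (norm (L2_inner M (v t) z - L2_inner M (s n t) z)) \<partial>?N) \<longlonglongrightarrow> 0"
    proof (rule tendsto_sandwich[OF always_eventually always_eventually tendsto_const])
      show "\<forall>n. (\<integral>\<^sup>+t. ennreal (norm (L2_inner M (v t) z - L2_inner M (s n t) z)) \<partial>?N)
          \<le> ennreal (L2_norm M z) * (\<integral>\<^sup>+t. ennreal (L2_norm M (\<lambda>x. v t x - s n t x)) \<partial>?N)"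
      proof
        fix n
        have "(\<integral>\<^sup>+t. ennreal (norm (L2_inner M (v t) z - L2_inner M (s n t) z)) \<partial>?N)
            \<le> (\<integral>\<^sup>+t. ennreal (L2_norm M z) * ennreal (L2_norm M (\<lambda>x. v t x - s n t x)) \<partial>?N)"
          by (intro nn_integral_mono_AE, use diff_bound[of n] in eventually_elim)
            (simp add: ennreal_mult[symmetric] ennreal_leI)
        also have "\<dots> = ennreal (L2_norm M z) * (\<integral>\<^sup>+t. ennreal (L2_norm M (\<lambda>x. v t x - s n t x)) \<partial>?N)"
          by (rule nn_integral_cmult) (use diff_meas in measurable)
        finally show "(\<integral>\<^sup>+t. ennreal (norm (L2_inner M (v t) z - L2_inner M (s n t) z)) \<partial>?N)
          \<le> ennreal (L2_norm M z) * (\<integral>\<^sup>+t. ennreal (L2_norm M (\<lambda>x. v t x - s n t x)) \<partial>?N)" .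
      qed
      show "(\<lambda>n. ennreal (L2_norm M z) * (\<integral>\<^sup>+t. ennreal (L2_norm M (\<lambda>x. v t x - s n t x)) \<partial>?N)) \<longlonglongrightarrow> 0"
        using ennreal_tendsto_cmult[OF _ L1, of "ennreal (L2_norm M z)"] by simp
    qed simp
    have part: "Bochner_Integration.simple_bochner_integral ?N (\<lambda>t. L2_inner M (s n t) z)
        = L2_inner M (L2_simple_integral ?N (s n)) z" for n
    proof -
      have "Bochner_Integration.simple_bochner_integral ?N (\<lambda>t. L2_inner M (s n t) z)
          = (\<Sum>f\<in>s n ` space ?N. measure ?N {t \<in> space ?N. s n t = f} *\<^sub>R L2_inner M f z)"
        by (rule simple_bochner_integral_partition[OF sbi sf]) auto
      also have "\<dots> = L2_inner M (L2_simple_integral ?N (s n)) z"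
        unfolding L2_simple_integral_def
        by (subst L2_inner_sum_left) (auto simp: L2_inner_scale_left intro!: L2_space_scale sL z)
      finally show ?thesis .
    qed
    have siL: "L2_simple_integral ?N (s n) \<in> L2_space M" for n
      unfolding L2_simple_integral_def by (intro L2_space_sum L2_space_scale) (auto intro!: sL)
    have "(\<lambda>n. L2_inner M (L2_simple_integral ?N (s n)) z - L2_inner M y z) \<longlonglongrightarrow> 0"
    proof (rule Lim_null_comparison[OF always_eventually tendsto_mult_left_zero[OF int, of "L2_norm M z"]], rule allI)
      fix n
      show "norm (L2_inner M (L2_simple_integral ?N (s n)) z - L2_inner M y z)
          \<le> L2_norm M (\<lambda>x. y x - L2_simple_integral ?N (s n) x) * L2_norm M z"
        using L2_Cauchy_Schwarz[OF L2_space_diff[OF y siL[of n]] z] L2_inner_diff_left[OF y siL[of n] z]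
        by (simp add: abs_minus_commute)
    qed
    then show "(\<lambda>n. Bochner_Integration.simple_bochner_integral ?N (\<lambda>t. L2_inner M (s n t) z)) \<longlonglongrightarrow> L2_inner M y z"
      unfolding part by (rule LIM_zero_cancel)
  qed
qed

lemma has_integral_le_off_negligible:
  fixes f g :: "real \<Rightarrow> real"
  assumes "(f has_integral i) S" "(g has_integral j) S" and N: "negligible N"
    and le: "\<And>x. x \<in> S - N \<Longrightarrow> f x \<le> g x"
  shows "i \<le> j"
proof -
  have "((\<lambda>x. if x \<in> N then g x else f x) has_integral i) S"
    by (rule has_integral_spike[OF N _ assms(1)]) auto
  then show ?thesis
    by (rule has_integral_le[OF _ assms(2)]) (use le in auto)
qed

lemma W11_with_derivative_integrals:
  assumes W: "W11_with_derivative M T u v" and T: "T > 0"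
  shows "\<And>t. t \<in> {0..T} \<Longrightarrow> u t \<in> L2_space M"
    and "(\<lambda>t. L2_norm M (v t)) integrable_on {0..T}"
    and "\<And>z s t. z \<in> L2_space M \<Longrightarrow> 0 \<le> s \<Longrightarrow> s \<le> t \<Longrightarrow> t \<le> T \<Longrightarrow>
      ((\<lambda>\<tau>. L2_inner M (v \<tau>) z) has_integral L2_inner M (\<lambda>x. u t x - u s x) z) {s..t}"
proof -
  show uL: "u t \<in> L2_space M" if "t \<in> {0..T}" for t
    using W that by (simp add: W11_with_derivative_def)
  have I: "has_L2_integral M (lebesgue_on {0..t}) v (\<lambda>x. u t x - u 0 x)" if "t \<in> {0..T}" for t
    using W that by (simp add: W11_with_derivative_def)
  show "(\<lambda>t. L2_norm M (v t)) integrable_on {0..T}"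
    using T by (intro integrable_on_lebesgue_on has_L2_integral_norm[OF I]) auto
  fix z s t assume z: "z \<in> L2_space M" and st: "0 \<le> s" "s \<le> t" "t \<le> T"
  let ?f = "\<lambda>\<tau>. L2_inner M (v \<tau>) z"
  have from_0: "(?f has_integral L2_inner M (\<lambda>x. u t x - u 0 x) z) {0..t}" if "t \<in> {0..T}" for t
  proof -
    have "has_bochner_integral (lebesgue_on {0..t}) ?f (L2_inner M (\<lambda>x. u t x - u 0 x) z)"
      by (rule has_L2_integral_inner[OF I[OF that] z])
    then show ?thesis
      using has_integral_integral_lebesgue_on[of "{0..t}" ?f]
      by (auto simp: has_bochner_integral_iff)
  qed
  have int: "?f integrable_on {0..t}"
    using from_0[of t] st by (auto simp: integrable_on_def)
  have "integral {0..s} ?f + integral {s..t} ?f = integral {0..t} ?f"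
    by (rule Henstock_Kurzweil_Integration.integral_combine[OF st(1,2) int])
  then have "integral {s..t} ?f = L2_inner M (\<lambda>x. u t x - u 0 x) z - L2_inner M (\<lambda>x. u s x - u 0 x) z"
    using from_0[of t] from_0[of s] st by (simp add: integral_unique)
  also have "\<dots> = L2_inner M (\<lambda>x. u t x - u s x) z"
    using st z uL by (simp add: L2_inner_diff_left)
  finally show "(?f has_integral L2_inner M (\<lambda>x. u t x - u s x) z) {s..t}"
    using integrable_on_subinterval[OF int, of s t] st by (auto simp: has_integral_integrable_integral)
qed

text \<open>A function whose increments are bounded above by squared increments of a continuous monotone
  $V$ cannot increase: cut the interval into $n$ pieces on each of which $V$ grows by the same
  amount, so that the total is at most $C\,(V(b)-V(a))^2/n$.\<close>

lemma antitone_if_increments_quadratic: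
  fixes G V :: "real \<Rightarrow> real"
  assumes ab: "a \<le> b" and cont: "continuous_on {a..b} V"
    and mono: "\<And>s t. a \<le> s \<Longrightarrow> s \<le> t \<Longrightarrow> t \<le> b \<Longrightarrow> V s \<le> V t"
    and quad: "\<And>s t. a \<le> s \<Longrightarrow> s \<le> t \<Longrightarrow> t \<le> b \<Longrightarrow> G t - G s \<le> C * (V t - V s)\<^sup>2"
  shows "G b \<le> G a"
proof -
  let ?d = "V b - V a"
  have "?d \<ge> 0" using mono[of a b] ab by simp
  then consider "?d = 0" | "?d > 0" by linarith
  then show ?thesis
  proof cases
    case 1
    then show ?thesis using quad[of a b] ab by simp
  next
    case 2
    have step: "G b - G a \<le> C * ?d\<^sup>2 * inverse (real (Suc k))" for k
    proof -
      define n where "n = Suc k"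
      have n: "real n > 0" by (simp add: n_def)
      define p where "p i = V a + real i / real n * ?d" for i
      have "\<exists>t. a \<le> t \<and> t \<le> b \<and> V t = p i" if "i \<le> n" for i
      proof (rule IVT'[OF _ _ ab cont])
        show "V a \<le> p i" using 2 by (simp add: p_def)
        have "real i / real n * ?d \<le> 1 * ?d"
          using that n 2 by (intro mult_right_mono) auto
        then show "p i \<le> V b" by (simp add: p_def)
      qed
      then obtain t' where t': "\<And>i. i \<le> n \<Longrightarrow> a \<le> t' i \<and> t' i \<le> b \<and> V (t' i) = p i"
        by metis
      define t where "t i = (if i = 0 then a else if i = n then b else t' i)" for i
      have t: "a \<le> t i" "t i \<le> b" "V (t i) = p i" if "i \<le> n" for i
        using t'[OF that] ab n by (auto simp: t_def p_def)
      have inc: "G (t (Suc i)) - G (t i) \<le> C * (?d / real n)\<^sup>2" if "i < n" for i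
      proof -
        have gap: "V (t (Suc i)) - V (t i) = ?d / real n"
          using t(3)[of i] t(3)[of "Suc i"] that n by (simp add: p_def field_simps)
        have "t i \<le> t (Suc i)"
        proof (rule ccontr)
          assume "\<not> t i \<le> t (Suc i)"
          then have "V (t (Suc i)) \<le> V (t i)"
            using t[of i] t[of "Suc i"] that by (intro mono) auto
          moreover have "?d / real n > 0" using 2 n by simp
          ultimately show False using gap by simp
        qed
        then show ?thesis
          using quad[of "t i" "t (Suc i)"] t[of i] t[of "Suc i"] that gap by simp
      qed
      have "G b - G a = (\<Sum>i<n. G (t (Suc i)) - G (t i))"
        using sum_lessThan_telescope[of "\<lambda>i. G (t i)" n] n by (simp add: t_def)
      also have "\<dots> \<le> (\<Sum>i<n. C * (?d / real n)\<^sup>2)"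
        by (intro sum_mono inc) simp
      also have "\<dots> = C * ?d\<^sup>2 * inverse (real n)"
        using n by (simp add: field_simps power2_eq_square)
      finally show ?thesis by (simp add: n_def)
    qed
    have "(\<lambda>k. C * ?d\<^sup>2 * inverse (real (Suc k))) \<longlonglongrightarrow> C * ?d\<^sup>2 * 0"
      by (intro tendsto_mult tendsto_const LIMSEQ_inverse_real_of_nat)
    then have "G b - G a \<le> C * ?d\<^sup>2 * 0"
      by (rule LIMSEQ_le_const) (use step in auto)
    then show ?thesis by simp
  qed
qed

text \<open>The integrated form of $\frac{d}{dt}\|u-e\|^2=2\langle u_t,u-e\rangle$, for a constant bound on the
  right-hand side.  With $V(t)=\int_0^t\|v\|$,
  convexity of the squared norm gives
  $\|u(t)-e\|^2-\|u(s)-e\|^2\le 2\int_s^t\langle v(\tau),u(t)-e\rangle\,d\tau$, and replacing $u(t)$ by $u(\tau)$ under the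
  integral costs at most $\|v(\tau)\|\,(V(t)-V(s))$.  The error is quadratic in the
  increment of $V$ and so disappears on subdividing.\<close>

lemma W11_with_derivative_dissipation:
  assumes W: "W11_with_derivative M T u v" and T: "T > 0" and e: "e \<in> L2_space M"
    and N: "negligible N"
    and ab: "0 \<le> a" "a \<le> b" "b \<le> T"
    and vL: "\<And>\<tau>. \<tau> \<in> {a..b} - N \<Longrightarrow> v \<tau> \<in> L2_space M"
    and diss: "\<And>\<tau>. \<tau> \<in> {a..b} - N \<Longrightarrow> L2_inner M (v \<tau>) (\<lambda>x. u \<tau> x - e x) \<le> - \<kappa>"
  shows "(L2_norm M (\<lambda>x. u b x - e x))\<^sup>2 \<le> (L2_norm M (\<lambda>x. u a x - e x))\<^sup>2 - 2 * \<kappa> * (b - a)"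
proof -
  note uL = W11_with_derivative_integrals(1)[OF W T]
    and nint = W11_with_derivative_integrals(2)[OF W T]
    and increment = W11_with_derivative_integrals(3)[OF W T]
  define V where "V t = integral {0..t} (\<lambda>\<tau>. L2_norm M (v \<tau>))" for t
  define G where "G t = (L2_norm M (\<lambda>x. u t x - e x))\<^sup>2 + 2 * \<kappa> * t" for t
  have nint': "((\<lambda>\<tau>. L2_norm M (v \<tau>)) has_integral (V t - V s)) {s..t}" if "a \<le> s" "s \<le> t" "t \<le> b" for s t
  proof -
    have int: "(\<lambda>\<tau>. L2_norm M (v \<tau>)) integrable_on {0..t}"
      using nint by (rule integrable_on_subinterval) (use that ab in auto)
    have "integral {0..s} (\<lambda>\<tau>. L2_norm M (v \<tau>)) + integral {s..t} (\<lambda>\<tau>. L2_norm M (v \<tau>))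
        = integral {0..t} (\<lambda>\<tau>. L2_norm M (v \<tau>))"
      using that ab by (intro Henstock_Kurzweil_Integration.integral_combine int) auto
    then show ?thesis
      using integrable_on_subinterval[OF int, of s t] that ab
      by (auto simp: has_integral_integrable_integral V_def)
  qed
  have mono: "V s \<le> V t" if "a \<le> s" "s \<le> t" "t \<le> b" for s t
    using has_integral_nonneg[OF nint'[OF that]] by simp
  have cont: "continuous_on {a..b} V"
    using indefinite_integral_continuous_1[OF nint] unfolding V_def[abs_def]
    by (rule continuous_on_subset) (use ab in auto)
  have lip: "L2_norm M (\<lambda>x. u t x - u s x) \<le> V t - V s" if st: "a \<le> s" "s \<le> t" "t \<le> b" for s t
  proof -
    let ?z = "\<lambda>x. u t x - u s x"
    have z: "?z \<in> L2_space M"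
      using st ab by (intro L2_space_diff uL) auto
    have "L2_inner M ?z ?z \<le> (V t - V s) * L2_norm M ?z"
    proof (rule has_integral_le_off_negligible[OF increment[OF z] has_integral_mult_left[OF nint'[OF st]] N])
      fix \<tau> assume "\<tau> \<in> {s..t} - N"
      then have "v \<tau> \<in> L2_space M" using vL st by auto
      then show "L2_inner M (v \<tau>) ?z \<le> L2_norm M (v \<tau>) * L2_norm M ?z"
        using L2_Cauchy_Schwarz[OF _ z] abs_le_D1 by blast
    qed (use st ab in auto)
    then have "L2_norm M ?z * L2_norm M ?z \<le> (V t - V s) * L2_norm M ?z"
      by (simp add: L2_norm_square[symmetric] power2_eq_square)
    then show ?thesis
      using mono[OF st] L2_norm_nonneg[of M ?z]
      by (cases "L2_norm M ?z = 0") (auto simp: mult_le_cancel_right)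
  qed
  have "G b \<le> G a"
  proof (rule antitone_if_increments_quadratic[OF ab(2) cont mono])
    fix s t assume st: "a \<le> s" "s \<le> t" "t \<le> b"
    let ?w = "\<lambda>x. u t x - e x" and ?z = "\<lambda>x. u t x - u s x"
    have us: "u s \<in> L2_space M" and ut: "u t \<in> L2_space M"
      using st ab by (auto intro: uL)
    have w: "?w \<in> L2_space M" and z: "?z \<in> L2_space M"
      using us ut e by (auto intro: L2_space_diff)
    have "L2_inner M ?z ?w \<le> - \<kappa> * (t - s) + (V t - V s) * (V t - V s)"
    proof (rule has_integral_le_off_negligible[OF increment[OF w] _ N])
      show "((\<lambda>\<tau>. - \<kappa> + L2_norm M (v \<tau>) * (V t - V s)) has_integral
          - \<kappa> * (t - s) + (V t - V s) * (V t - V s)) {s..t}"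
        using has_integral_const_real[of "- \<kappa>" s t] st
        by (intro has_integral_add has_integral_mult_left nint' st) (simp add: mult.commute)
      fix \<tau> assume \<tau>: "\<tau> \<in> {s..t} - N"
      then have u\<tau>: "u \<tau> \<in> L2_space M" and v\<tau>: "v \<tau> \<in> L2_space M"
        using st ab by (auto intro: uL vL)
      have "L2_inner M (v \<tau>) ?w = L2_inner M (v \<tau>) (\<lambda>x. u \<tau> x - e x) + L2_inner M (v \<tau>) (\<lambda>x. u t x - u \<tau> x)"
        using u\<tau> v\<tau> ut e by (simp add: L2_inner_diff_right)
      also have "\<dots> \<le> - \<kappa> + L2_norm M (v \<tau>) * L2_norm M (\<lambda>x. u t x - u \<tau> x)"
        using diss[of \<tau>] \<tau> st L2_Cauchy_Schwarz[OF v\<tau> L2_space_diff[OF ut u\<tau>]] by force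
      also have "L2_norm M (v \<tau>) * L2_norm M (\<lambda>x. u t x - u \<tau> x) \<le> L2_norm M (v \<tau>) * (V t - V s)"
        using lip[of \<tau> t] mono[of s \<tau>] \<tau> st by (intro mult_left_mono) auto
      finally show "L2_inner M (v \<tau>) ?w \<le> - \<kappa> + L2_norm M (v \<tau>) * (V t - V s)" by simp
    qed (use st ab in auto)
    then have "2 * L2_inner M ?z ?w \<le> 2 * (V t - V s)\<^sup>2 - 2 * \<kappa> * t + 2 * \<kappa> * s"
      by (simp add: power2_eq_square algebra_simps)
    moreover have "(L2_norm M (\<lambda>x. u s x - e x))\<^sup>2
        = (L2_norm M ?w)\<^sup>2 - 2 * L2_inner M ?z ?w + (L2_norm M ?z)\<^sup>2"
      using L2_norm_square_diff[OF w z] by (simp add: L2_inner_commute)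
    moreover have "0 \<le> (L2_norm M ?z)\<^sup>2" by (rule zero_le_power2)
    ultimately show "G t - G s \<le> 2 * (V t - V s)\<^sup>2"
      unfolding G_def by linarith
  qed
  then show ?thesis
    by (simp add: G_def algebra_simps)
qed

section \<open>The total variation flow\<close>

context reversible_random_walk_space
begin

lemma TV_m_scale:
  assumes [measurable]: "u \<in> borel_measurable borel"
  shows "TV_m m \<nu> (\<lambda>x. c * u x) = ennreal \<bar>c\<bar> * TV_m m \<nu> u"
proof -
  have "(\<integral>\<^sup>+p. ennreal \<bar>c * u (snd p) - c * u (fst p)\<bar> \<partial>jump)
      = (\<integral>\<^sup>+p. ennreal \<bar>c\<bar> * ennreal \<bar>u (snd p) - u (fst p)\<bar> \<partial>jump)"
    by (simp add: right_diff_distrib[symmetric] abs_mult ennreal_mult)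
  also have "\<dots> = ennreal \<bar>c\<bar> * (\<integral>\<^sup>+p. ennreal \<bar>u (snd p) - u (fst p)\<bar> \<partial>jump)"
    by (rule nn_integral_cmult) measurable
  finally show ?thesis
    by (simp add: TV_m_eq_jump mult.left_commute)
qed

lemma TV_m_const [simp]: "TV_m m \<nu> (\<lambda>_. c) = 0"
  by (simp add: TV_m_def)

lemma TV_m_shift [simp]: "TV_m m \<nu> (\<lambda>x. u x - c) = TV_m m \<nu> u"
  by (simp add: TV_m_def)

text \<open>The subdifferential of an even, positively homogeneous functional: comparing $u$ with $0$ and
  with $2u$ gives Euler's identity, and then comparing it with $\pm z$ bounds the pairing with $z$.\<close>

lemma Delta_1_D:
  assumes v: "v \<in> Delta_1 m \<nu> u"
  shows "u \<in> L2_space \<nu>" "v \<in> L2_space \<nu>" "TV_m m \<nu> u < \<infinity>"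
    and "L2_inner \<nu> v u = - enn2real (TV_m m \<nu> u)"
    and "\<And>z. z \<in> L2_space \<nu> \<Longrightarrow> TV_m m \<nu> z < \<infinity> \<Longrightarrow> \<bar>L2_inner \<nu> v z\<bar> \<le> enn2real (TV_m m \<nu> z)"
proof -
  have mv: "(\<lambda>x. - v x) \<in> L2_space \<nu>" and u: "u \<in> L2_space \<nu>" and fin: "TV_m m \<nu> u < \<infinity>"
    and sub: "\<And>z. z \<in> L2_space \<nu> \<Longrightarrow>
      enn2ereal (TV_m m \<nu> z) \<ge> enn2ereal (TV_m m \<nu> u) + ereal (\<integral>x. - v x * (z x - u x) \<partial>\<nu>)"
    using v by (auto simp: Delta_1_def L2_subdifferential_def)
  have vL: "v \<in> L2_space \<nu>"
    using L2_space_scale[OF mv, of "-1"] by simp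
  show "u \<in> L2_space \<nu>" "v \<in> L2_space \<nu>" "TV_m m \<nu> u < \<infinity>" by fact+
  let ?F = "\<lambda>z. enn2real (TV_m m \<nu> z)"
  have ineq: "?F u - (L2_inner \<nu> v z - L2_inner \<nu> v u) \<le> ?F z"
    if z: "z \<in> L2_space \<nu>" and finz: "TV_m m \<nu> z < \<infinity>" for z
  proof -
    have "(\<integral>x. - v x * (z x - u x) \<partial>\<nu>) = - L2_inner \<nu> v (\<lambda>x. z x - u x)"
      by (simp add: L2_inner_def)
    also have "\<dots> = - (L2_inner \<nu> v z - L2_inner \<nu> v u)"
      by (simp add: L2_inner_diff_right z u vL)
    finally have int: "(\<integral>x. - v x * (z x - u x) \<partial>\<nu>) = - (L2_inner \<nu> v z - L2_inner \<nu> v u)" .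
    have "enn2ereal (TV_m m \<nu> w) = ereal (?F w)" if "TV_m m \<nu> w < \<infinity>" for w
      using that by (metis ennreal_enn2real enn2ereal_ennreal enn2real_nonneg infinity_ennreal_def)
    then show ?thesis
      using sub[OF z] fin finz unfolding int by simp
  qed
  have scale: "?F (\<lambda>x. c * z x) = \<bar>c\<bar> * ?F z" "TV_m m \<nu> (\<lambda>x. c * z x) < \<infinity>"
    if "z \<in> L2_space \<nu>" "TV_m m \<nu> z < \<infinity>" for z c
    using that by (auto simp: TV_m_scale[OF L2_space_borel] enn2real_mult ennreal_mult_less_top)
  have "?F u + L2_inner \<nu> v u \<le> 0"
    using ineq[OF L2_space_zero] by (simp add: L2_inner_def)
  moreover have "?F u + L2_inner \<nu> v u \<ge> 0"
    using ineq[OF L2_space_scale[OF u, of 2]] scale[OF u fin, of 2]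
    by (simp add: L2_inner_scale_right)
  ultimately show eq: "L2_inner \<nu> v u = - ?F u" by linarith
  fix z assume z: "z \<in> L2_space \<nu>" and finz: "TV_m m \<nu> z < \<infinity>"
  have "- L2_inner \<nu> v z \<le> ?F z"
    using ineq[OF z finz] eq by linarith
  moreover have "L2_inner \<nu> v z \<le> ?F z"
    using ineq[OF L2_space_scale[OF z, of "-1"] scale(2)[OF z finz]] scale(1)[OF z finz, of "-1"] eq
      L2_inner_scale_right[of \<nu> v "-1" z]
    by simp
  ultimately show "\<bar>L2_inner \<nu> v z\<bar> \<le> ?F z" by linarith
qed

text \<open>A function orthogonal to everything of finite dual norm is invariant under the walk and hence
  constant, so $f$, being orthogonal to the constants, is in the closure.\<close>

lemma TV_dual_approximation:
  assumes conn: "m_connected m \<nu>" and f: "f \<in> L2_space \<nu>"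
    and orth: "\<And>r c. r \<in> L2_space \<nu> \<Longrightarrow> (AE x in \<nu>. r x = c) \<Longrightarrow> L2_inner \<nu> f r = 0"
    and e: "e > 0"
  shows "\<exists>g\<in>TV_dual. L2_norm \<nu> (\<lambda>x. f x - g x) < e"
proof (rule L2_approximation_by_subspace[OF _ _ TV_dual_add TV_dual_scale f _ e])
  show "TV_dual \<subseteq> L2_space \<nu>"
    by (auto simp: TV_dual_def)
  show "(\<lambda>_. 0) \<in> TV_dual"
    by (auto simp: TV_dual_def L2_space_zero L2_inner_def intro!: exI[of _ 0])
  fix r assume r: "r \<in> L2_space \<nu>" and perp: "\<And>g. g \<in> TV_dual \<Longrightarrow> L2_inner \<nu> r g = 0"
  have "\<exists>c. AE x in \<nu>. r x = c"
    using jump_invariant_imp_AE_constant[OF conn L2_space_borel[OF r]]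
      perp_TV_dual_imp_jump_invariant[OF r perp] by blast
  then show "L2_inner \<nu> f r = 0"
    using orth[OF r] by blast
qed

lemma total_variation_flow_D:
  assumes flow: "total_variation_flow m \<nu> u0 u" and T: "T > 0"
  obtains v N where "W11_with_derivative \<nu> T u v" "negligible N"
    "\<And>t. t \<in> {0..T} - N \<Longrightarrow> v t \<in> Delta_1 m \<nu> (u t)"
proof -
  obtain v where W: "W11_with_derivative \<nu> T u v"
    and AE: "AE t in lebesgue_on {0..T}. v t \<in> Delta_1 m \<nu> (u t)"
    using flow T by (auto simp: total_variation_flow_def)
  have "AE t in lebesgue. t \<in> {0..T} \<longrightarrow> v t \<in> Delta_1 m \<nu> (u t)"
    using AE by (subst (asm) AE_restrict_space_iff) auto
  then obtain N where "N \<in> null_sets lebesgue"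
    "\<And>t. t \<in> space lebesgue - N \<Longrightarrow> t \<in> {0..T} \<longrightarrow> v t \<in> Delta_1 m \<nu> (u t)"
    by (rule AE_E3) blast
  then show ?thesis
    using W by (intro that[of v N]) (auto simp: negligible_iff_null_sets)
qed

text \<open>The velocity of the flow has dual norm at most one, so the displacement has dual norm at
  most $t$.\<close>

lemma total_variation_flow_increment:
  assumes flow: "total_variation_flow m \<nu> u0 u" and t: "t \<ge> 0"
    and z: "z \<in> L2_space \<nu>" and fin: "TV_m m \<nu> z < \<infinity>"
  shows "L2_inner \<nu> (\<lambda>x. u t x - u 0 x) z \<le> t * enn2real (TV_m m \<nu> z)"
proof -
  obtain v N where W: "W11_with_derivative \<nu> (t + 1) u v" and N: "negligible N"
    and v: "\<And>s. s \<in> {0..t + 1} - N \<Longrightarrow> v s \<in> Delta_1 m \<nu> (u s)"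
    using total_variation_flow_D[OF flow, of "t + 1"] t by auto
  show ?thesis
  proof (rule has_integral_le_off_negligible[OF W11_with_derivative_integrals(3)[OF W _ z] _ N])
    show "((\<lambda>_. enn2real (TV_m m \<nu> z)) has_integral t * enn2real (TV_m m \<nu> z)) {0..t}"
      using has_integral_const_real[of "enn2real (TV_m m \<nu> z)" 0 t] t by simp
    fix s assume "s \<in> {0..t} - N"
    then show "L2_inner \<nu> (v s) z \<le> enn2real (TV_m m \<nu> z)"
      using Delta_1_D(5)[OF v z fin, of s] by force
  qed (use t in auto)
qed

text \<open>Subtracting a constant changes neither the total variation nor, because a constant has total
  variation zero, the pairing of $u$ with the velocity.\<close>

lemma total_variation_flow_dissipation:
  assumes flow: "total_variation_flow m \<nu> u0 u" and c: "(\<lambda>_. c) \<in> L2_space \<nu>"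
    and ab: "0 \<le> a" "a \<le> b"
    and diss: "\<And>\<tau>. \<tau> \<in> {a..b} \<Longrightarrow> TV_m m \<nu> (u \<tau>) < \<infinity> \<Longrightarrow> \<kappa> \<le> enn2real (TV_m m \<nu> (u \<tau>))"
  shows "(L2_norm \<nu> (\<lambda>x. u b x - c))\<^sup>2 \<le> (L2_norm \<nu> (\<lambda>x. u a x - c))\<^sup>2 - 2 * \<kappa> * (b - a)"
proof -
  obtain v N where W: "W11_with_derivative \<nu> (b + 1) u v" and N: "negligible N"
    and v: "\<And>s. s \<in> {0..b + 1} - N \<Longrightarrow> v s \<in> Delta_1 m \<nu> (u s)"
    using total_variation_flow_D[OF flow, of "b + 1"] ab by auto
  show ?thesis
  proof (rule W11_with_derivative_dissipation[OF W _ c N ab])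
    fix \<tau> assume \<tau>: "\<tau> \<in> {a..b} - N"
    then have "v \<tau> \<in> Delta_1 m \<nu> (u \<tau>)" using v ab by auto
    note D = Delta_1_D[OF this]
    show "v \<tau> \<in> L2_space \<nu>" by (rule D)
    have "\<bar>L2_inner \<nu> (v \<tau>) (\<lambda>_. c)\<bar> \<le> 0"
      using D(5)[OF c] by simp
    then have "L2_inner \<nu> (v \<tau>) (\<lambda>x. u \<tau> x - c) = - enn2real (TV_m m \<nu> (u \<tau>))"
      using L2_inner_diff_right[OF D(1) c D(2)] D(4) by simp
    then show "L2_inner \<nu> (v \<tau>) (\<lambda>x. u \<tau> x - c) \<le> - \<kappa>"
      using diss[of \<tau>] \<tau> D(3) by simp
  qed (use ab in auto)
qed

text \<open>If $\|u(t)-c\|\ge\eta$ for all $t$, the lower bound on the dissipation takes away a fixed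
  amount of $\|u(t)-c\|^2$ on every interval $[t,2t]$, which cannot go on forever.  Hence
  $\|u(t)-c\|$ becomes small at some time, and being nonincreasing it stays small.\<close>

lemma total_variation_flow_tendsto:
  assumes conn: "m_connected m \<nu>" and u0: "u0 \<in> L2_space \<nu>" and c: "(\<lambda>_. c) \<in> L2_space \<nu>"
    and orth: "\<And>r c'. r \<in> L2_space \<nu> \<Longrightarrow> (AE x in \<nu>. r x = c') \<Longrightarrow> L2_inner \<nu> (\<lambda>x. u0 x - c) r = 0"
    and flow: "total_variation_flow m \<nu> u0 u"
  shows "((\<lambda>t. L2_norm \<nu> (\<lambda>x. u t x - c)) \<longlongrightarrow> 0) at_top"
proof -
  define Y where "Y t = L2_norm \<nu> (\<lambda>x. u t x - c)" for t
  have uL: "u t \<in> L2_space \<nu>" if "t \<ge> 0" for t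
  proof -
    have "t + 1 > 0" using that by simp
    from total_variation_flow_D[OF flow this] obtain v where "W11_with_derivative \<nu> (t + 1) u v"
      by blast
    then show ?thesis
      using that by (intro W11_with_derivative_integrals(1)[of \<nu> "t + 1" u v]) auto
  qed
  have wL: "(\<lambda>x. u t x - c) \<in> L2_space \<nu>" if "t \<ge> 0" for t
    by (rule L2_space_diff[OF uL[OF that] c])
  have decreasing: "Y b \<le> Y a" if "0 \<le> a" "a \<le> b" for a b
    using total_variation_flow_dissipation[OF flow c that, of 0]
    by (intro power2_le_imp_le[of "Y b"]) (auto simp: Y_def)
  have "\<exists>t\<ge>0. Y t < \<eta>" if \<eta>: "\<eta> > 0" for \<eta>
  proof (rule ccontr)
    assume "\<not> (\<exists>t\<ge>0. Y t < \<eta>)"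
    then have far: "Y t \<ge> \<eta>" if "t \<ge> 0" for t
      using that by force
    have R: "Y 0 > 0" using far[of 0] \<eta> by simp
    (* The approximation error, multiplied by the norm of u(0) - c, then uses up half of eta^2. *)
    define \<epsilon> where "\<epsilon> = \<eta>\<^sup>2 / (2 * Y 0)"
    have \<epsilon>: "\<epsilon> > 0" using \<eta> R by (simp add: \<epsilon>_def)
    have "\<exists>f\<in>TV_dual. L2_norm \<nu> (\<lambda>x. (u 0 x - c) - f x) < \<epsilon>"
    proof (rule TV_dual_approximation[OF conn wL _ \<epsilon>])
      fix r c' assume r: "r \<in> L2_space \<nu>" "AE x in \<nu>. r x = c'"
      have "AE x in \<nu>. u 0 x = u0 x"
        using flow by (simp add: total_variation_flow_def)
      then have "AE x in \<nu>. (u 0 x - c) * r x = (u0 x - c) * r x"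
        by eventually_elim simp
      then have "L2_inner \<nu> (\<lambda>x. u 0 x - c) r = L2_inner \<nu> (\<lambda>x. u0 x - c) r"
        unfolding L2_inner_def
        by (rule integral_cong_AE[rotated 2])
          (use L2_integrable_mult[OF wL[of 0] r(1)] L2_integrable_mult[OF L2_space_diff[OF u0 c] r(1)] in auto)
      then show "L2_inner \<nu> (\<lambda>x. u 0 x - c) r = 0"
        using orth[OF r] by simp
    qed simp
    then obtain f K where f: "f \<in> L2_space \<nu>" and K: "K \<ge> 0"
      and approx: "L2_norm \<nu> (\<lambda>x. (u 0 x - c) - f x) < \<epsilon>"
      and dual: "\<And>z. z \<in> L2_space \<nu> \<Longrightarrow> TV_m m \<nu> z < \<infinity> \<Longrightarrow> \<bar>L2_inner \<nu> f z\<bar> \<le> K * enn2real (TV_m m \<nu> z)"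
      by (auto simp: TV_dual_def)
    have lower: "\<eta>\<^sup>2 / 2 \<le> (t + K) * enn2real (TV_m m \<nu> (u t))"
      if t: "t \<ge> 0" and fin: "TV_m m \<nu> (u t) < \<infinity>" for t
    proof -
      let ?w = "\<lambda>x. u t x - c" and ?F = "enn2real (TV_m m \<nu> (u t))"
      let ?g = "\<lambda>x. (u 0 x - c) - f x"
      have g: "?g \<in> L2_space \<nu>"
        by (rule L2_space_diff[OF wL f]) simp
      have finw: "TV_m m \<nu> ?w < \<infinity>" using fin by simp
      have "\<eta>\<^sup>2 \<le> (Y t)\<^sup>2"
        using far[OF t] \<eta> by (intro power_mono) auto
      also have "\<dots> = L2_inner \<nu> ?w ?w"
        by (simp add: Y_def L2_norm_square)
      also have "\<dots> = L2_inner \<nu> (\<lambda>x. u t x - u 0 x) ?w + L2_inner \<nu> ?g ?w + L2_inner \<nu> f ?w"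
        using L2_inner_diff_left[OF uL[OF t] c wL[OF t]]
          L2_inner_diff_left[OF uL[OF t] uL[OF order_refl] wL[OF t]]
          L2_inner_diff_left[OF wL[OF order_refl] f wL[OF t]]
          L2_inner_diff_left[OF uL[OF order_refl] c wL[OF t]] by simp
      also have "\<dots> \<le> t * ?F + \<epsilon> * Y 0 + K * ?F"
      proof (intro add_mono)
        show "L2_inner \<nu> (\<lambda>x. u t x - u 0 x) ?w \<le> t * ?F"
          using total_variation_flow_increment[OF flow t wL[OF t] finw] by simp
        have "L2_inner \<nu> ?g ?w \<le> L2_norm \<nu> ?g * Y t"
          using L2_Cauchy_Schwarz[OF g wL[OF t]] by (simp add: Y_def)
        also have "\<dots> \<le> \<epsilon> * Y 0"
          using approx decreasing[OF order_refl t] \<epsilon> by (intro mult_mono) (auto simp: Y_def)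
        finally show "L2_inner \<nu> ?g ?w \<le> \<epsilon> * Y 0" .
        show "L2_inner \<nu> f ?w \<le> K * ?F"
          using dual[OF wL[OF t] finw] by simp
      qed
      finally show ?thesis
        using R by (simp add: \<epsilon>_def distrib_right)
    qed
    (* From time t0 on, K is at most t, so that (tau + K) is at most 3 * t on the interval from t
       to 2 * t. *)
    define t0 where "t0 = max K 1"
    have drop: "(Y (2 * t))\<^sup>2 \<le> (Y t)\<^sup>2 - \<eta>\<^sup>2 / 3" if t: "t \<ge> t0" for t
    proof -
      have tpos: "t > 0" "K \<le> t" using t by (auto simp: t0_def)
      have "(Y (2 * t))\<^sup>2 \<le> (Y t)\<^sup>2 - 2 * (\<eta>\<^sup>2 / (6 * t)) * (2 * t - t)"
        unfolding Y_def
      proof (rule total_variation_flow_dissipation[OF flow c])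
        fix \<tau> assume \<tau>: "\<tau> \<in> {t..2 * t}" and fin: "TV_m m \<nu> (u \<tau>) < \<infinity>"
        have "\<eta>\<^sup>2 / 2 \<le> (\<tau> + K) * enn2real (TV_m m \<nu> (u \<tau>))"
          using \<tau> tpos fin by (intro lower) auto
        also have "\<dots> \<le> (3 * t) * enn2real (TV_m m \<nu> (u \<tau>))"
          using \<tau> tpos by (intro mult_right_mono) auto
        finally show "\<eta>\<^sup>2 / (6 * t) \<le> enn2real (TV_m m \<nu> (u \<tau>))"
          using tpos by (simp add: field_simps)
      qed (use tpos in auto)
      then show ?thesis using tpos by simp
    qed
    have "(Y (2 ^ n * t0))\<^sup>2 \<le> (Y t0)\<^sup>2 - real n * (\<eta>\<^sup>2 / 3)" for n
    proof (induction n)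
      case (Suc n)
      have "1 * t0 \<le> 2 ^ n * t0"
        by (intro mult_right_mono) (auto simp: t0_def)
      then have "(Y (2 * (2 ^ n * t0)))\<^sup>2 \<le> (Y (2 ^ n * t0))\<^sup>2 - \<eta>\<^sup>2 / 3"
        by (intro drop) simp
      then show ?case
        using Suc.IH by (simp add: mult.assoc distrib_right add_divide_distrib)
    qed simp
    then have "0 \<le> (Y t0)\<^sup>2 - real n * (\<eta>\<^sup>2 / 3)" for n
      by (rule order_trans[OF zero_le_power2])
    then have "real n * (\<eta>\<^sup>2 / 3) \<le> (Y t0)\<^sup>2" for n
      by simp
    moreover obtain n where "real n * (\<eta>\<^sup>2 / 3) > (Y t0)\<^sup>2"
      using reals_Archimedean3[of "\<eta>\<^sup>2 / 3"] \<eta> by auto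
    ultimately show False by (meson not_less)
  qed
  then have ev: "\<forall>\<^sub>F t in at_top. Y t < \<eta>" if "\<eta> > 0" for \<eta>
    using that decreasing unfolding eventually_at_top_linorder by (meson order.strict_trans1)
  show ?thesis
    unfolding Y_def[symmetric]
  proof (rule order_tendstoI)
    show "\<forall>\<^sub>F t in at_top. a < Y t" if "a < 0" for a
      using that by (intro always_eventually allI) (auto simp: Y_def intro: less_le_trans)
    show "\<forall>\<^sub>F t in at_top. Y t < a" if "0 < a" for a
      by (rule ev[OF that])
  qed
qed

lemma zero_in_Delta_1_const:
  assumes "(\<lambda>_. c) \<in> L2_space \<nu>"
  shows "(\<lambda>_. 0) \<in> Delta_1 m \<nu> (\<lambda>_. c)"
  using assms by (auto simp: Delta_1_def L2_subdifferential_def L2_space_zero zero_ennreal.rep_eq zero_ereal_def[symmetric])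

text \<open>The two cases of total mass: the mean of $u_0$ makes $u_0-c$ orthogonal to the constants, and
  for infinite mass the zero function is the only constant in $L^2$.\<close>

lemma limit_value:
  assumes u0: "u0 \<in> L2_space \<nu>"
  shows "\<exists>c. (\<lambda>_. c) \<in> L2_space \<nu> \<and>
    (\<forall>r c'. r \<in> L2_space \<nu> \<longrightarrow> (AE x in \<nu>. r x = c') \<longrightarrow> L2_inner \<nu> (\<lambda>x. u0 x - c) r = 0) \<and>
    (emeasure \<nu> UNIV < \<infinity> \<longrightarrow> c = 1 / measure \<nu> UNIV * (\<integral>y. u0 y \<partial>\<nu>))"
proof (cases "emeasure \<nu> UNIV < \<infinity>")
  case True
  then interpret finite_measure \<nu>
    by (intro finite_measureI) auto
  define c where "c = 1 / measure \<nu> UNIV * (\<integral>y. u0 y \<partial>\<nu>)"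
  have const: "(\<lambda>_. b) \<in> L2_space \<nu>" for b
    by (simp add: L2_space_def)
  have int: "integrable \<nu> u0"
    using L2_integrable_mult[OF u0 const[of 1]] by simp
  have mean: "(\<integral>x. u0 x - c \<partial>\<nu>) = 0"
  proof (cases "measure \<nu> UNIV = 0")
    case True
    then have "AE x in \<nu>. False"
      by (intro AE_I[of _ _ UNIV]) (auto simp: sets_nu emeasure_eq_measure)
    then show ?thesis
      by (intro integral_eq_zero_AE) (auto elim: eventually_mono)
  next
    case False
    then show ?thesis
      using int by (simp add: c_def)
  qed
  have "L2_inner \<nu> (\<lambda>x. u0 x - c) r = 0"
    if r: "r \<in> L2_space \<nu>" "AE x in \<nu>. r x = c'" for r c'
  proof -
    have "L2_inner \<nu> (\<lambda>x. u0 x - c) r = (\<integral>x. (u0 x - c) * c' \<partial>\<nu>)"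
      unfolding L2_inner_def
      using r u0 by (intro integral_cong_AE) (auto simp: L2_space_def elim: eventually_mono)
    then show ?thesis using mean by simp
  qed
  then show ?thesis
    using const[of c] c_def by auto
next
  case False
  have "L2_inner \<nu> (\<lambda>x. u0 x - 0) r = 0" if r: "r \<in> L2_space \<nu>" "AE x in \<nu>. r x = c'" for r c'
  proof -
    have "integrable \<nu> (\<lambda>x. c'\<^sup>2)"
      by (rule integrable_cong_AE_imp[OF L2_spaceD(2)[OF r(1)]]) (use r(2) in \<open>auto elim: eventually_mono\<close>)
    then have "c' = 0"
      using False by (auto simp: integrable_iff_bounded ennreal_mult_less_top top.not_eq_extremum)
    then show ?thesis
      unfolding L2_inner_def using r(2) by (intro integral_eq_zero_AE) (auto elim: eventually_mono)
  qed
  then show ?thesis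
    using False L2_space_zero by (intro exI[of _ 0]) auto
qed

end

theorem proposition4p1:
  fixes m :: "'a::polish_space \<Rightarrow> 'a measure" and \<nu> :: "'a measure" and u0 :: "'a \<Rightarrow> real"
  assumes "reversible_random_walk_space m \<nu>"
    and "m_connected m \<nu>"
    and "u0 \<in> L2_space \<nu>"
  shows "\<exists>u_inf. (\<lambda>_. 0) \<in> Delta_1 m \<nu> u_inf \<and>
    (\<forall>u. total_variation_flow m \<nu> u0 u \<longrightarrow>
       ((\<lambda>t. L2_norm \<nu> (\<lambda>x. u t x - u_inf x)) \<longlongrightarrow> 0) at_top) \<and>
    (emeasure \<nu> (space \<nu>) < \<infinity> \<longrightarrow>
       (AE x in \<nu>. u_inf x = 1 / measure \<nu> (space \<nu>) * (\<integral>y. u0 y \<partial>\<nu>)))"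
proof -
  interpret reversible_random_walk_space m \<nu> by fact
  obtain c where c: "(\<lambda>_. c) \<in> L2_space \<nu>"
    and orth: "\<And>r c'. r \<in> L2_space \<nu> \<Longrightarrow> (AE x in \<nu>. r x = c') \<Longrightarrow> L2_inner \<nu> (\<lambda>x. u0 x - c) r = 0"
    and mean: "emeasure \<nu> UNIV < \<infinity> \<Longrightarrow> c = 1 / measure \<nu> UNIV * (\<integral>y. u0 y \<partial>\<nu>)"
    using limit_value[OF assms(3)] by blast
  show ?thesis
    using zero_in_Delta_1_const[OF c] mean
      total_variation_flow_tendsto[OF assms(2,3) c orth]
    by (intro exI[of _ "\<lambda>_. c"]) auto
qed

end
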